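(* Let $0<\varepsilon\le 1/4$ be fixed. Assume $\textsf{ALG}$ is a randomized algorithm that, for any function $f:\{0,1\}^n\to\{0,1\}$ and any distribution $\mathcal{D}$ over $\{0,1\}^n$, takes at most $m$ independent samples $S$ from $\mathcal{D}$ and makes at most $M$ queries to $f$, outputs a bit $\textsf{ALG}(f,S)\in\{0,1\}$, and satisfies: if $f$ is a monotone decision list then $\Pr_{\textsf{ALG},S\sim\mathcal{D}}[\textsf{ALG}(f,S)=1]\ge 5/6$; and if $f$ is $\varepsilon$-far from linear threshold functions under $\mathcal{D}$ then $\Pr_{\textsf{ALG},S\sim\mathcal{D}}[\textsf{ALG}(f,S)=0]\ge 5/6$. Then $m+M=\Omega(\sqrt{n}/\log n)$.
   Context: A monotone decision list is $f:\{0,1\}^n\to\{0,1\}$ given by a permutation $\pi$ of $[n]$ and $\nu\in\{0,1\}^{n+1}$ with $f(x)=\nu_j$ for the smallest $j$ such that $x_{\pi(j)}=1$, and $f(0^n)=\nu_{n+1}$. A linear threshold function is $g(x)=\mathbb{1}[w\cdot x\ge\theta]$ for some $w\in\mathbb{R}^n,\theta\in\mathbb{R}$. $f$ is $\varepsilon$-far from linear threshold functions under $\mathcal{D}$ if $\Pr_{x\sim\mathcal{D}}[f(x)\neq g(x)]\ge\varepsilon$ for every linear threshold function $g$. The queries of $\textsf{ALG}$ may be adaptive. *)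

theory Defs
  imports "HOL-Probability.Probability" "HOL-Combinatorics.Permutations"
begin

type_synonym point = "bool list"

definition cube :: "nat \<Rightarrow> point set" where
  "cube n = {x. length x = n}"

text \<open>
  A function on the \<open>n\<close>-cube is a function on all bit lists whose values outside
  \<^term>\<open>cube n\<close> are irrelevant. Indices start at \<open>0\<close>: coordinates range over \<open>0, \<dots>, n - 1\<close>,
  and the value vector of a decision list over \<open>0, \<dots>, n\<close>.
\<close>

definition monotone_decision_list :: "nat \<Rightarrow> (point \<Rightarrow> bool) \<Rightarrow> bool" where
  "monotone_decision_list n f \<longleftrightarrow>
     (\<exists>(\<pi> :: nat \<Rightarrow> nat) (\<nu> :: nat \<Rightarrow> bool). \<pi> permutes {..<n} \<and>
       (\<forall>x\<in>cube n. f x =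
          (if \<exists>j<n. x ! \<pi> j then \<nu> (LEAST j. j < n \<and> x ! \<pi> j) else \<nu> n)))"

definition linear_threshold :: "nat \<Rightarrow> (point \<Rightarrow> bool) \<Rightarrow> bool" where
  "linear_threshold n g \<longleftrightarrow>
     (\<exists>(w :: nat \<Rightarrow> real) (\<theta> :: real).
       \<forall>x\<in>cube n. g x \<longleftrightarrow> (\<Sum>i<n. w i * of_bool (x ! i)) \<ge> \<theta>)"

definition far_from_linear_threshold ::
    "real \<Rightarrow> nat \<Rightarrow> point pmf \<Rightarrow> (point \<Rightarrow> bool) \<Rightarrow> bool" where
  "far_from_linear_threshold \<epsilon> n D f \<longleftrightarrow>
     (\<forall>g. linear_threshold n g \<longrightarrow> measure_pmf.prob D {x. f x \<noteq> g x} \<ge> \<epsilon>)"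

text \<open>
  Deterministic algorithms are adaptive strategies in which sampling and querying may be
  interleaved and every action may depend on all samples and answers seen so far.
  Samples carry no label; learning the value of \<open>f\<close> at a sampled point costs a query.
\<close>

datatype det_alg =
    Output bool
  | Query point "bool \<Rightarrow> det_alg"
  | Sample "point \<Rightarrow> det_alg"

text \<open>
  The list \<open>S\<close> supplies the samples in order; unused ones are ignored.
  On strategies respecting a sample bound \<open>m \<le> length S\<close> it never runs empty.
\<close>

primrec run :: "det_alg \<Rightarrow> (point \<Rightarrow> bool) \<Rightarrow> point list \<Rightarrow> bool" where
  "run (Output b) f S = b"
| "run (Query x k) f S = run (k (f x)) f S"
| "run (Sample k) f S = run (k (hd S)) f (tl S)"

inductive bounded_alg :: "nat \<Rightarrow> nat \<Rightarrow> nat \<Rightarrow> det_alg \<Rightarrow> bool" for n :: nat where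
  "bounded_alg n m M (Output b)"
| "x \<in> cube n \<Longrightarrow> (\<And>b. bounded_alg n m M (k b)) \<Longrightarrow> bounded_alg n m (Suc M) (Query x k)"
| "(\<And>x. x \<in> cube n \<Longrightarrow> bounded_alg n m M (k x)) \<Longrightarrow> bounded_alg n (Suc m) M (Sample k)"

text \<open>
  A randomized algorithm is a probability distribution over deterministic ones. Discrete
  distributions lose no generality: for fixed \<open>n\<close>, \<open>m\<close>, \<open>M\<close> there are, up to behaviour on
  \<^term>\<open>cube n\<close>, only finitely many deterministic algorithms.
\<close>

definition randomized_alg :: "nat \<Rightarrow> nat \<Rightarrow> nat \<Rightarrow> det_alg pmf \<Rightarrow> bool" where
  "randomized_alg n m M ALG \<longleftrightarrow> (\<forall>A\<in>set_pmf ALG. bounded_alg n m M A)"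

definition prob_output ::
    "det_alg pmf \<Rightarrow> nat \<Rightarrow> (point \<Rightarrow> bool) \<Rightarrow> point pmf \<Rightarrow> bool \<Rightarrow> real" where
  "prob_output ALG m f D b =
     measure_pmf.prob (pair_pmf ALG (replicate_pmf m D)) {(A, S). run A f S = b}"

end

theory Submission
  imports Defs "HOL-Real_Asymp.Real_Asymp"
begin

text \<open>
  Assign the coordinates to positions by a random permutation. Half of the positions are junk: they
  come first in the decision list and all have value 1. The other half is split into blocks of four
  roles with values \<open>1, 0, 0, 1\<close>, and each block is listed forwards or backwards according to a
  random bit. The distribution is uniform on the edges \<open>01, 23, 02, 13\<close> of all blocks. In the
  no-instance the values of the edges containing role \<open>2\<close> are flipped; then \<open>01\<close> and \<open>23\<close>
  have one value and \<open>02\<close> and \<open>13\<close> the other, while \<open>01 + 23 = 02 + 13\<close> as vectors, so every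
  linear threshold function errs on a quarter of the mass.

  As long as the algorithm sees at most one edge per block, the flip can be undone by changing the
  bit of that block, so the two instances look alike. Two samples from one block are unlikely by the
  birthday bound. A query with more than \<open>3 ln n\<close> unseen coordinates very likely contains junk
  and is answered 1; the other queries expose \<open>O(ln n)\<close> coordinates each, so altogether only a small
  multiple of \<open>sqrt n\<close> coordinates is exposed and again no two of them share a block.
\<close>

section \<open>Uniform permutations with some values exposed\<close>

text \<open>Conditioning in counting form: \<phi> is the information revealed, its fibres partition
  \<open>X\<close>, and a bound \<beta> on the bad fraction of every fibre survives averaging.
  Probabilities over the random permutation are handled as such counts.\<close>

lemma card_le_by_fibres:
  fixes \<beta> :: real
  assumes "finite X"
    and "\<And>x. x \<in> X \<Longrightarrow> real (card {y\<in>X. \<phi> y = \<phi> x \<and> B y}) \<le> \<beta> * real (card {y\<in>X. \<phi> y = \<phi> x})"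
  shows "real (card {y\<in>X. B y}) \<le> \<beta> * real (card X)"
proof -
  have "card {y\<in>X. B y} = card (\<Union>v\<in>\<phi> ` X. {y\<in>X. \<phi> y = v \<and> B y})"
    by (rule arg_cong[where f = card]) auto
  also have "\<dots> = (\<Sum>v\<in>\<phi> ` X. card {y\<in>X. \<phi> y = v \<and> B y})"
    by (rule card_UN_disjoint) (use assms(1) in auto)
  finally have "real (card {y\<in>X. B y}) = (\<Sum>v\<in>\<phi> ` X. real (card {y\<in>X. \<phi> y = v \<and> B y}))"
    by simp
  also have "\<dots> \<le> (\<Sum>v\<in>\<phi> ` X. \<beta> * real (card {y\<in>X. \<phi> y = v}))"
    by (rule sum_mono) (use assms(2) in auto)
  also have "\<dots> = \<beta> * real (\<Sum>v\<in>\<phi> ` X. card {y\<in>X. \<phi> y = v})"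
    by (simp add: sum_distrib_left)
  also have "(\<Sum>v\<in>\<phi> ` X. card {y\<in>X. \<phi> y = v}) = card (\<Union>v\<in>\<phi> ` X. {y\<in>X. \<phi> y = v})"
    by (rule card_UN_disjoint[symmetric]) (use assms(1) in auto)
  also have "(\<Union>v\<in>\<phi> ` X. {y\<in>X. \<phi> y = v}) = X" by auto
  finally show ?thesis .
qed

text \<open>The sample space of the uniform permutation once its values on \<open>K\<close> have
  been exposed; \<open>\<rho>\<^sub>0\<close> carries these values.\<close>

definition agreeing :: "nat \<Rightarrow> (nat \<Rightarrow> nat) \<Rightarrow> nat set \<Rightarrow> (nat \<Rightarrow> nat) set" where
  "agreeing n \<rho>\<^sub>0 K = {\<rho>. \<rho> permutes {..<n} \<and> (\<forall>i\<in>K. \<rho> i = \<rho>\<^sub>0 i)}"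

lemma finite_agreeing [simp]: "finite (agreeing n \<rho>\<^sub>0 K)"
  by (rule finite_subset[OF _ finite_permutations[of "{..<n}"]]) (auto simp: agreeing_def)

lemma agreeing_fibre:
  assumes "\<rho>\<^sub>1 \<in> agreeing n \<rho>\<^sub>0 K" "K \<subseteq> K'"
  shows "{\<rho> \<in> agreeing n \<rho>\<^sub>0 K. restrict \<rho> K' = restrict \<rho>\<^sub>1 K'} = agreeing n \<rho>\<^sub>1 K'"
proof -
  have "restrict \<rho> K' = restrict \<rho>\<^sub>1 K' \<longleftrightarrow> (\<forall>i\<in>K'. \<rho> i = \<rho>\<^sub>1 i)" for \<rho>
    by (metis restrict_apply' restrict_ext)
  then show ?thesis using assms by (auto simp: agreeing_def subset_iff)
qed

text \<open>Deferred decisions: reveal the values on \<open>K'\<close> too, bound the conditional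
  fraction whatever they turn out to be, and average.\<close>

lemma card_agreeing_by_exposure:
  fixes \<beta> :: real
  assumes "K \<subseteq> K'"
    and "\<And>\<rho>\<^sub>1. \<rho>\<^sub>1 \<in> agreeing n \<rho>\<^sub>0 K \<Longrightarrow>
           real (card {\<rho> \<in> agreeing n \<rho>\<^sub>1 K'. B \<rho>}) \<le> \<beta> * real (card (agreeing n \<rho>\<^sub>1 K'))"
  shows "real (card {\<rho> \<in> agreeing n \<rho>\<^sub>0 K. B \<rho>}) \<le> \<beta> * real (card (agreeing n \<rho>\<^sub>0 K))"
proof (rule card_le_by_fibres[where \<phi> = "\<lambda>\<rho>. restrict \<rho> K'"])
  fix \<rho>\<^sub>1 assume r: "\<rho>\<^sub>1 \<in> agreeing n \<rho>\<^sub>0 K"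
  have "{\<rho> \<in> agreeing n \<rho>\<^sub>0 K. restrict \<rho> K' = restrict \<rho>\<^sub>1 K' \<and> B \<rho>} = {\<rho> \<in> agreeing n \<rho>\<^sub>1 K'. B \<rho>}"
    using agreeing_fibre[OF r assms(1)] by blast
  then show "real (card {\<rho> \<in> agreeing n \<rho>\<^sub>0 K. restrict \<rho> K' = restrict \<rho>\<^sub>1 K' \<and> B \<rho>})
      \<le> \<beta> * real (card {\<rho> \<in> agreeing n \<rho>\<^sub>0 K. restrict \<rho> K' = restrict \<rho>\<^sub>1 K'})"
    using agreeing_fibre[OF r assms(1)] assms(2)[OF r] by simp
qed simp

lemma card_agreeing_value:
  assumes \<rho>\<^sub>0: "\<rho>\<^sub>0 permutes {..<n}" and K: "K \<subseteq> {..<n}" and i: "i < n" "i \<notin> K"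
  shows "card {\<rho> \<in> agreeing n \<rho>\<^sub>0 K. \<rho> i = p} * (n - card K) \<le> card (agreeing n \<rho>\<^sub>0 K)"
proof (cases "p < n \<and> p \<notin> \<rho>\<^sub>0 ` K")
  \<comment> \<open>Here \<open>p\<close> is out of range or already the value of a coordinate in
    \<open>K\<close>, so the event is empty.\<close>
  case False
  have "\<rho> i \<noteq> p" if "\<rho> \<in> agreeing n \<rho>\<^sub>0 K" for \<rho>
  proof
    assume "\<rho> i = p"
    from that have p: "\<rho> permutes {..<n}" and eq: "\<And>j. j \<in> K \<Longrightarrow> \<rho> j = \<rho>\<^sub>0 j"
      by (auto simp: agreeing_def)
    have "\<rho> i < n" using permutes_in_image[OF p, of i] i by simp
    with False \<open>\<rho> i = p\<close> obtain j where "j \<in> K" "\<rho> i = \<rho> j" using eq by auto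
    then have "i = j" using permutes_inj[OF p] by (meson injD)
    with i \<open>j \<in> K\<close> show False by simp
  qed
  then have "card {\<rho> \<in> agreeing n \<rho>\<^sub>0 K. \<rho> i = p} = 0" by auto
  then show ?thesis by (simp only: mult_0 le0)
next
  case True
  define U where "U = {..<n} - \<rho>\<^sub>0 ` K"
  have K': "\<rho>\<^sub>0 ` K \<subseteq> {..<n}" using permutes_image[OF \<rho>\<^sub>0] K by blast
  have cU: "card U = n - card K"
  proof -
    have "card (\<rho>\<^sub>0 ` K) = card K"
      by (rule card_image) (rule inj_on_subset[OF permutes_inj[OF \<rho>\<^sub>0]], simp)
    then show ?thesis
      unfolding U_def using card_Diff_subset[OF finite_subset[OF K'] K'] by simp
  qed
  have le: "card {\<rho> \<in> agreeing n \<rho>\<^sub>0 K. \<rho> i = p} \<le> card {\<rho> \<in> agreeing n \<rho>\<^sub>0 K. \<rho> i = p'}"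
    if p': "p' \<in> U" for p'
  proof (rule card_inj_on_le[where f = "\<lambda>\<rho>. Transposition.transpose p p' \<circ> \<rho>"])
    show "inj_on (\<lambda>\<rho>. Transposition.transpose p p' \<circ> \<rho>) {\<rho> \<in> agreeing n \<rho>\<^sub>0 K. \<rho> i = p}"
    proof (rule inj_onI)
      fix \<rho> \<rho>' :: "nat \<Rightarrow> nat"
      assume "Transposition.transpose p p' \<circ> \<rho> = Transposition.transpose p p' \<circ> \<rho>'"
      then have "Transposition.transpose p p' (Transposition.transpose p p' (\<rho> j))
          = Transposition.transpose p p' (Transposition.transpose p p' (\<rho>' j))" for j
        by (metis comp_apply)
      then show "\<rho> = \<rho>'" by (simp add: fun_eq_iff)
    qed
    show "(\<lambda>\<rho>. Transposition.transpose p p' \<circ> \<rho>) ` {\<rho> \<in> agreeing n \<rho>\<^sub>0 K. \<rho> i = p} \<subseteq> {\<rho> \<in> agreeing n \<rho>\<^sub>0 K. \<rho> i = p'}"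
    proof safe
      fix \<rho> assume r: "\<rho> \<in> agreeing n \<rho>\<^sub>0 K" "p = \<rho> i"
      have "Transposition.transpose p p' \<circ> \<rho> permutes {..<n}"
        by (rule permutes_compose) (use r True p' in \<open>auto simp: agreeing_def U_def intro: permutes_swap_id\<close>)
      moreover have "Transposition.transpose p p' (\<rho> j) = \<rho>\<^sub>0 j" if "j \<in> K" for j
        using r(1) that True p' by (auto simp: agreeing_def U_def Transposition.transpose_def)
      ultimately show "Transposition.transpose (\<rho> i) p' \<circ> \<rho> \<in> agreeing n \<rho>\<^sub>0 K"
        unfolding r(2) by (simp add: agreeing_def)
    qed simp
  qed simp
  have "card {\<rho> \<in> agreeing n \<rho>\<^sub>0 K. \<rho> i = p} * (n - card K)
      = (\<Sum>p'\<in>U. card {\<rho> \<in> agreeing n \<rho>\<^sub>0 K. \<rho> i = p})" by (simp add: cU)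
  also have "\<dots> \<le> (\<Sum>p'\<in>U. card {\<rho> \<in> agreeing n \<rho>\<^sub>0 K. \<rho> i = p'})"
    by (rule sum_mono) (rule le)
  also have "\<dots> = card (\<Union>p'\<in>U. {\<rho> \<in> agreeing n \<rho>\<^sub>0 K. \<rho> i = p'})"
    by (rule card_UN_disjoint[symmetric]) (auto simp: U_def)
  also have "\<dots> \<le> card (agreeing n \<rho>\<^sub>0 K)" by (rule card_mono) auto
  finally show ?thesis .
qed

lemma card_agreeing_value_in:
  assumes "\<rho>\<^sub>0 permutes {..<n}" "K \<subseteq> {..<n}" "i < n" "i \<notin> K" "finite W"
  shows "card {\<rho> \<in> agreeing n \<rho>\<^sub>0 K. \<rho> i \<in> W} * (n - card K) \<le> card W * card (agreeing n \<rho>\<^sub>0 K)"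
proof -
  have "card {\<rho> \<in> agreeing n \<rho>\<^sub>0 K. \<rho> i \<in> W} = card (\<Union>p\<in>W. {\<rho> \<in> agreeing n \<rho>\<^sub>0 K. \<rho> i = p})"
    by (rule arg_cong[where f = card]) auto
  also have "\<dots> \<le> (\<Sum>p\<in>W. card {\<rho> \<in> agreeing n \<rho>\<^sub>0 K. \<rho> i = p})"
    by (rule card_UN_le) (rule assms)
  finally have "card {\<rho> \<in> agreeing n \<rho>\<^sub>0 K. \<rho> i \<in> W} * (n - card K)
      \<le> (\<Sum>p\<in>W. card {\<rho> \<in> agreeing n \<rho>\<^sub>0 K. \<rho> i = p} * (n - card K))"
    by (simp add: sum_distrib_right[symmetric])
  also have "\<dots> \<le> (\<Sum>p\<in>W. card (agreeing n \<rho>\<^sub>0 K))"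
    by (rule sum_mono) (rule card_agreeing_value[OF assms(1-4)])
  finally show ?thesis by simp
qed

text \<open>Expose \<open>Y\<close> one coordinate at a time; each lands in \<open>W\<close> with
  conditional probability at most \<open>r\<close>. The condition on \<open>r\<close> involves
  \<open>card K + card Y\<close>, which does not change when a coordinate moves from
  \<open>Y\<close> to \<open>K\<close>, so it passes through the induction.\<close>

lemma card_agreeing_image_subset:
  fixes r :: real
  assumes "finite Y" "\<rho>\<^sub>0 permutes {..<n}" "K \<subseteq> {..<n}" "Y \<subseteq> {..<n} - K" "finite W"
    and "real (card W) \<le> r * (real n - real (card K) - real (card Y))" "0 \<le> r"
  shows "real (card {\<rho> \<in> agreeing n \<rho>\<^sub>0 K. \<rho> ` Y \<subseteq> W}) \<le> r ^ card Y * real (card (agreeing n \<rho>\<^sub>0 K))"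
  using assms
proof (induction Y arbitrary: K \<rho>\<^sub>0 rule: finite_induct)
  case empty
  then show ?case by simp
next
  case (insert y Y)
  let ?X = "{\<rho> \<in> agreeing n \<rho>\<^sub>0 K. \<rho> y \<in> W}"
  have yK: "y < n" "y \<notin> K" using insert.prems by auto
  have fK: "finite K" using insert.prems finite_subset by blast
  have step: "real (card {\<rho> \<in> ?X. \<rho> ` Y \<subseteq> W}) \<le> r ^ card Y * real (card ?X)"
  proof (rule card_le_by_fibres[where \<phi> = "\<lambda>\<rho>. restrict \<rho> (insert y K)"])
    fix \<rho>\<^sub>1 assume "\<rho>\<^sub>1 \<in> ?X"
    then have r1: "\<rho>\<^sub>1 \<in> agreeing n \<rho>\<^sub>0 K" "\<rho>\<^sub>1 y \<in> W" by auto
    have F: "{\<rho> \<in> agreeing n \<rho>\<^sub>0 K. restrict \<rho> (insert y K) = restrict \<rho>\<^sub>1 (insert y K)}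
        = agreeing n \<rho>\<^sub>1 (insert y K)" by (rule agreeing_fibre[OF r1(1)]) auto
    have y: "\<And>\<rho>. \<rho> \<in> agreeing n \<rho>\<^sub>1 (insert y K) \<Longrightarrow> \<rho> y \<in> W" using r1 by (simp add: agreeing_def)
    have 1: "{\<rho> \<in> ?X. restrict \<rho> (insert y K) = restrict \<rho>\<^sub>1 (insert y K) \<and> \<rho> ` Y \<subseteq> W}
        = {\<rho> \<in> agreeing n \<rho>\<^sub>1 (insert y K). \<rho> ` Y \<subseteq> W}"
      using F y by blast
    have 2: "{\<rho> \<in> ?X. restrict \<rho> (insert y K) = restrict \<rho>\<^sub>1 (insert y K)} = agreeing n \<rho>\<^sub>1 (insert y K)"
      using F y by blast
    show "real (card {\<rho> \<in> ?X. restrict \<rho> (insert y K) = restrict \<rho>\<^sub>1 (insert y K) \<and> \<rho> ` Y \<subseteq> W})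
       \<le> r ^ card Y * real (card {\<rho> \<in> ?X. restrict \<rho> (insert y K) = restrict \<rho>\<^sub>1 (insert y K)})"
      unfolding 1 2
    proof (rule insert.IH)
      show "\<rho>\<^sub>1 permutes {..<n}" using r1 by (simp add: agreeing_def)
      show "Y \<subseteq> {..<n} - insert y K" using insert by auto
      show "real (card W) \<le> r * (real n - real (card (insert y K)) - real (card Y))"
        using insert.prems insert.hyps yK fK by (simp add: algebra_simps)
    qed (use insert.prems in auto)
  qed simp
  have kn: "card K \<le> n" using card_mono[OF _ insert.prems(2)] by simp
  have "real (card ?X) * (real n - real (card K)) \<le> real (card W) * real (card (agreeing n \<rho>\<^sub>0 K))"
    using card_agreeing_value_in[OF insert.prems(1,2) yK insert.prems(4), folded of_nat_le_iff[where 'a = real]] kn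
    by (simp add: of_nat_diff)
  also have "\<dots> \<le> (r * (real n - real (card K))) * real (card (agreeing n \<rho>\<^sub>0 K))"
  proof (rule mult_right_mono)
    have "r * (real n - real (card K) - real (card (insert y Y))) \<le> r * (real n - real (card K))"
      by (rule mult_left_mono) (use insert.prems in auto)
    then show "real (card W) \<le> r * (real n - real (card K))" using insert.prems(5) by linarith
  qed simp
  finally have "real (card ?X) * (real n - real (card K))
    \<le> (r * real (card (agreeing n \<rho>\<^sub>0 K))) * (real n - real (card K))" by (simp add: mult_ac)
  moreover have "card K < n" using yK insert.prems(2)
    by (metis card_lessThan finite_lessThan lessThan_iff psubsetI psubset_card_mono)
  ultimately have X: "real (card ?X) \<le> r * real (card (agreeing n \<rho>\<^sub>0 K))"
    by simp
  have "{\<rho> \<in> agreeing n \<rho>\<^sub>0 K. \<rho> ` insert y Y \<subseteq> W} = {\<rho> \<in> ?X. \<rho> ` Y \<subseteq> W}" by auto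
  then have "real (card {\<rho> \<in> agreeing n \<rho>\<^sub>0 K. \<rho> ` insert y Y \<subseteq> W}) \<le> r ^ card Y * real (card ?X)"
    using step by simp
  also have "\<dots> \<le> r ^ card Y * (r * real (card (agreeing n \<rho>\<^sub>0 K)))"
    by (rule mult_left_mono[OF X]) (use insert.prems in simp)
  finally show ?case using insert.hyps by (simp add: mult_ac)
qed

section \<open>Blocks and the two functions\<close>

definition supp :: "point \<Rightarrow> nat set" where
  "supp x = {i. i < length x \<and> x ! i}"

lemma finite_supp [simp]: "finite (supp x)"
  by (simp add: supp_def)

lemma supp_subset_cube: "x \<in> cube n \<Longrightarrow> supp x \<subseteq> {..<n}"
  by (auto simp: supp_def cube_def)

text \<open>Positions below \<open>J\<close> are junk; position \<open>J + 4 * b + r\<close> with \<open>r < 4\<close> has role \<open>r\<close> in block \<open>b\<close>.\<close>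

definition block :: "nat \<Rightarrow> nat \<Rightarrow> nat" where
  "block J p = (p - J) div 4"

text \<open>The lower bounds matter: truncated subtraction in \<open>block\<close> would put all
  junk positions into block 0.\<close>

definition same_block :: "nat \<Rightarrow> nat \<Rightarrow> nat \<Rightarrow> bool" where
  "same_block J p q \<longleftrightarrow> J \<le> p \<and> J \<le> q \<and> block J p = block J q"

definition pos_value :: "nat \<Rightarrow> nat \<Rightarrow> bool" where
  "pos_value J p \<longleftrightarrow> p < J \<or> (p - J) mod 4 \<in> {0, 3}"

text \<open>The index in the decision list; the blocks in \<open>t\<close> are listed in reverse order of roles.\<close>

definition prio :: "nat \<Rightarrow> nat set \<Rightarrow> nat \<Rightarrow> nat" where
  "prio J t p = (if J \<le> p \<and> block J p \<in> t then J + 4 * block J p + (3 - (p - J) mod 4) else p)"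

text \<open>\<open>P\<close> is the set of positions occupied by the ones of the input. The value is
  read off the list index instead of the position, which is harmless because 1, 0, 0, 1 is a
  palindrome. The empty set stands for the all-zero input.\<close>

definition yes_val :: "nat \<Rightarrow> nat set \<Rightarrow> nat set \<Rightarrow> bool" where
  "yes_val J t P \<longleftrightarrow> P \<noteq> {} \<and> pos_value J (Min (prio J t ` P))"

text \<open>The first block met by \<open>P\<close> is met exactly in an edge containing role \<open>2\<close>, and \<open>P\<close> avoids junk.\<close>

definition flipped :: "nat \<Rightarrow> nat set \<Rightarrow> bool" where
  "flipped J P \<longleftrightarrow> (\<exists>b. P \<inter> {..<J + 4 * b + 4} \<in>
      {{J + 4 * b, J + 4 * b + 2}, {J + 4 * b + 2, J + 4 * b + 3}})"

definition no_val :: "nat \<Rightarrow> nat set \<Rightarrow> nat set \<Rightarrow> bool" where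
  "no_val J t P \<longleftrightarrow> yes_val J t P \<noteq> flipped J P"

text \<open>The edges form the 4-cycle 0, 1, 3, 2. Indices 0, 1 and indices 2, 3 are its two perfect
  matchings, hence the later test \<open>e < 2\<close>; role 2 lies on edges 1 and 2.\<close>

definition edge :: "nat \<Rightarrow> nat \<times> nat \<Rightarrow> nat set" where
  "edge J = (\<lambda>(b, e). (\<lambda>r. J + 4 * b + r) ` ([{0, 1}, {2, 3}, {0, 2}, {1, 3}] ! e))"

section \<open>Arithmetic of blocks, roles and reversed listings\<close>

lemma edge_simps [simp]:
  "edge J (b, 0) = {J + 4 * b, J + 4 * b + 1}"
  "edge J (b, Suc 0) = {J + 4 * b + 2, J + 4 * b + 3}"
  "edge J (b, 2) = {J + 4 * b, J + 4 * b + 2}"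
  "edge J (b, 3) = {J + 4 * b + 1, J + 4 * b + 3}"
  by (auto simp: edge_def numeral_eq_Suc)

lemma less_4_cases: "e < (4::nat) \<Longrightarrow> e = 0 \<or> e = Suc 0 \<or> e = 2 \<or> e = 3"
  by auto

lemma edge_block: "e < 4 \<Longrightarrow> p \<in> edge J (b, e) \<Longrightarrow> J \<le> p \<and> block J p = b"
  by (drule less_4_cases) (auto simp: block_def)

lemma card_edge: "e < 4 \<Longrightarrow> card (edge J (b, e)) = 2"
  by (drule less_4_cases) auto

lemma finite_edge: "e < 4 \<Longrightarrow> finite (edge J (b, e))"
  by (drule less_4_cases) auto

lemma block_pos [simp]: "r < 4 \<Longrightarrow> block J (J + 4 * b + r) = b"
  by (simp add: block_def add.assoc)

lemma block_mono: "p \<le> q \<Longrightarrow> block J p \<le> block J q"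
  unfolding block_def by (intro div_le_mono diff_le_mono)

lemma prio_pos: "r < 4 \<Longrightarrow> prio J t (J + 4 * b + r) = J + 4 * b + (if b \<in> t then 3 - r else r)"
  unfolding prio_def by (simp add: add.assoc) (simp add: add.assoc[symmetric])

lemma pos_value_pos: "r < 4 \<Longrightarrow> pos_value J (J + 4 * b + r) \<longleftrightarrow> r \<in> {0, 3}"
  by (simp add: pos_value_def add.assoc)

lemma pos_cases:
  obtains (junk) "p < J" | (pos) b r where "p = J + 4 * b + r" "r < (4::nat)"
proof (cases "p < J")
  case False
  then have "p = J + 4 * ((p - J) div 4) + (p - J) mod 4" by simp
  then show thesis by (rule pos) simp
qed (rule junk)

lemma prio_junk: "prio J t p < J \<longleftrightarrow> p < J"
  by (auto simp: prio_def)

lemma prio_block: "J \<le> p \<Longrightarrow> J \<le> prio J t p \<and> block J (prio J t p) = block J p"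
proof (cases p J rule: pos_cases)
  case (pos b r)
  then show ?thesis using prio_pos[of r J t b] block_pos[of "3 - r" J b] block_pos[of r J b] by (auto simp del: block_pos)
qed simp

lemma prio_prio [simp]: "prio J t (prio J t p) = p"
proof (cases p J rule: pos_cases)
  case (pos b r)
  then show ?thesis using prio_pos[of "3 - r" J t b] prio_pos[of r J t b] by auto
qed (simp add: prio_def)

lemma pos_value_prio [simp]: "pos_value J (prio J t p) = pos_value J p"
proof (cases p J rule: pos_cases)
  case (pos b r)
  then show ?thesis using pos_value_pos[of "3 - r" J b] pos_value_pos[of r J b] prio_pos[of r J t b]
    by auto
qed (simp add: prio_def)

lemma prio_less:
  assumes "J + 4 * N = n" "p < n"
  shows "prio J t p < n"
proof (cases p J rule: pos_cases)
  case (pos b r)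
  then have "b < N" using assms by linarith
  then have "J + 4 * b + 4 \<le> n" using assms by linarith
  then show ?thesis using pos by (auto simp: prio_pos)
qed (use assms in \<open>auto simp: prio_def\<close>)

text \<open>\<open>prio\<close> is an involution mapping \<open>{..<n}\<close> into itself. The case
  distinction is there because \<open>permutes\<close> demands the identity outside, where
  \<open>prio\<close> may still reverse blocks.\<close>

lemma prio_permutes:
  assumes "J + 4 * N = n"
  shows "(\<lambda>p. if p < n then prio J t p else p) permutes {..<n}"
proof (rule bij_imp_permutes)
  show "bij_betw (\<lambda>p. if p < n then prio J t p else p) {..<n} {..<n}"
    by (rule bij_betwI[where g = "prio J t"]) (use prio_less[OF assms] in auto)
qed auto

text \<open>\<open>prio\<close> maps no block position below \<open>J\<close> and keeps junk there,
  so the first index met is a junk index, and those have value 1.\<close>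

lemma yes_val_junk:
  assumes "finite P" "p \<in> P" "p < J"
  shows "yes_val J t P"
proof -
  have "Min (prio J t ` P) < J"
    using assms by (subst Min_less_iff) (auto simp: prio_junk)
  then show ?thesis using assms by (auto simp: yes_val_def pos_value_def)
qed

lemma mem_flip_pattern: "X \<in> {{a, c}, {c, d}} \<Longrightarrow> p \<in> X \<Longrightarrow> p = a \<or> p = c \<or> p = d"
  by auto

text \<open>Only a block whose positions are exactly a sampled edge can tell the two functions
  apart, and there reversing the block compensates for the flip.\<close>

lemma no_val_eq_yes_val:
  assumes fin: "finite P"
    and S: "\<And>b e. (b, e) \<in> S \<Longrightarrow> e < 4" and inj: "inj_on fst S"
    and good: "(\<exists>p\<in>P. p < J) \<or>
       (\<forall>p\<in>P. \<forall>q\<in>P. p \<noteq> q \<longrightarrow> same_block J p q \<longrightarrow> p \<in> (\<Union>s\<in>S. edge J s) \<and> q \<in> (\<Union>s\<in>S. edge J s))"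
  shows "no_val J (sym_diff t {b. (b, 1) \<in> S \<or> (b, 2) \<in> S}) P = yes_val J t P"
proof -
  define t' where "t' = sym_diff t {b. (b, 1) \<in> S \<or> (b, 2) \<in> S}"
  consider (empty) "P = {}" | (junk) p where "p \<in> P" "p < J" | (blocks) "P \<noteq> {}" "\<forall>p\<in>P. J \<le> p"
    by (meson not_le)
  then have "no_val J t' P = yes_val J t P"
  proof cases
    case empty
    then show ?thesis by (auto simp: no_val_def yes_val_def flipped_def)
  next
    case junk
    have "yes_val J u P" for u by (rule yes_val_junk[OF fin junk])
    moreover have "\<not> flipped J P"
    proof
      assume "flipped J P"
      then obtain b where b: "P \<inter> {..<J + 4 * b + 4} \<in>
          {{J + 4 * b, J + 4 * b + 2}, {J + 4 * b + 2, J + 4 * b + 3}}" unfolding flipped_def by blast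
      have "p \<in> P \<inter> {..<J + 4 * b + 4}" using junk by auto
      with junk(2) show False by (auto dest!: mem_flip_pattern[OF b] simp del: Int_iff)
    qed
    ultimately show ?thesis by (simp add: no_val_def)
  next
    case blocks
    \<comment> \<open>\<open>b\<close> is the first block met by \<open>P\<close> and
      \<open>B\<close> the part of \<open>P\<close> inside it; both values will depend on
      \<open>B\<close> alone.\<close>
    define b where "b = block J (Min P)"
    define B where "B = P \<inter> {..<J + 4 * b + 4}"
    have minP: "Min P \<in> P" using blocks fin by simp
    have block_ge: "b \<le> block J p" if "p \<in> P" for p
      unfolding b_def using that fin by (intro block_mono) simp
    have mem: "p \<in> B \<longleftrightarrow> p \<in> P \<and> block J p = b" for p
    proof -
      have "p < J + 4 * b + 4 \<longleftrightarrow> block J p \<le> b" if "p \<in> P"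
        using blocks that by (auto simp: block_def)
      then show ?thesis using block_ge by (auto simp: B_def intro: antisym)
    qed
    have Bne: "B \<noteq> {}" and Bfin: "finite B"
      using mem[of "Min P"] minP fin by (auto simp: b_def B_def)
    \<comment> \<open>The block in the existential of \<open>flipped\<close> must be the first one
      met: the truncated set contains \<open>Min P\<close>, and its pattern places
      \<open>Min P\<close> in block \<open>c\<close>.\<close>
    have first: "P \<inter> {..<J + 4 * c + 4} = B"
      if "P \<inter> {..<J + 4 * c + 4} \<in> {{J + 4 * c, J + 4 * c + 2}, {J + 4 * c + 2, J + 4 * c + 3}}" for c
    proof -
      have "Min P \<in> P \<inter> {..<J + 4 * c + 4}"
      proof -
        have "P \<inter> {..<J + 4 * c + 4} \<noteq> {}" using that by (metis insertE insert_not_empty singletonD)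
        then obtain q where "q \<in> P" "q < J + 4 * c + 4" by blast
        then show ?thesis using minP Min_le[OF fin, of q] by auto
      qed
      then have "Min P = J + 4 * c \<or> Min P = J + 4 * c + 2 \<or> Min P = J + 4 * c + 3"
        by (rule mem_flip_pattern[OF that])
      then have "b = c" by (auto simp: b_def block_def)
      then show ?thesis by (simp add: B_def)
    qed
    have flip: "flipped J P \<longleftrightarrow> B \<in> {{J + 4 * b, J + 4 * b + 2}, {J + 4 * b + 2, J + 4 * b + 3}}"
    proof
      assume "flipped J P"
      then obtain c where c: "P \<inter> {..<J + 4 * c + 4} \<in>
          {{J + 4 * c, J + 4 * c + 2}, {J + 4 * c + 2, J + 4 * c + 3}}" unfolding flipped_def by blast
      then have "J + 4 * c + 2 \<in> B" unfolding first[OF c] by (metis insertCI insertE singletonD)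
      then have "block J (J + 4 * c + 2) = b" using mem by blast
      then have "c = b" by (simp add: block_def)
      then show "B \<in> {{J + 4 * b, J + 4 * b + 2}, {J + 4 * b + 2, J + 4 * b + 3}}"
        using c by (simp add: B_def)
    qed (unfold flipped_def B_def, blast)
    \<comment> \<open>Reversals act within blocks and keep the order between blocks, so a later
      block cannot supply the minimum.\<close>
    have MinB: "Min (prio J u ` P) = Min (prio J u ` B)" for u
    proof (rule Min_eqI)
      fix y assume "y \<in> prio J u ` P"
      then obtain p where p: "p \<in> P" "y = prio J u p" by auto
      show "Min (prio J u ` B) \<le> y"
      proof (cases "p \<in> B")
        case True
        then show ?thesis using p Bfin by simp
      next
        case False
        obtain q where q: "q \<in> B" using Bne by blast
        have "b < block J p"
          using False p mem[of p] block_ge[of p] by auto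
        then have "block J (prio J u q) < block J (prio J u p)"
          using prio_block[of J p u] prio_block[of J q u] q mem p blocks by auto
        then have "prio J u q \<le> prio J u p"
          using block_mono[of "prio J u p" "prio J u q" J] by linarith
        moreover have "Min (prio J u ` B) \<le> prio J u q" using q Bfin by simp
        ultimately show ?thesis using p by simp
      qed
    next
      have "Min (prio J u ` B) \<in> prio J u ` B" by (rule Min_in) (use Bne Bfin in auto)
      then show "Min (prio J u ` B) \<in> prio J u ` P" by (auto simp: B_def)
    qed (use fin in simp)
    have y: "yes_val J u P = pos_value J (Min (prio J u ` B))" for u
      using blocks by (simp add: yes_val_def MinB)
    show ?thesis
    proof (cases "\<exists>p. B = {p}")
      \<comment> \<open>A single position gives its own value whatever the orientation of the block,
        and the flip pattern needs two positions.\<close>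
      case True
      then have "\<not> flipped J P" using flip by auto
      moreover have "yes_val J u P = yes_val J v P" for u v using True by (auto simp: y)
      ultimately show ?thesis by (auto simp: no_val_def)
    next
      case False
      \<comment> \<open>With two positions in one block, the hypothesis puts all of \<open>B\<close>
        on sampled edges, and injectivity of \<open>fst\<close> leaves only one sampled edge in this
        block; so \<open>B\<close> is that edge.\<close>
      have two: "\<exists>q\<in>B. q \<noteq> p" for p
      proof (rule ccontr)
        assume "\<not> (\<exists>q\<in>B. q \<noteq> p)"
        then have "B = {p}" using Bne by auto
        with False show False by simp
      qed
      have BQ: "p \<in> (\<Union>s\<in>S. edge J s)" if "p \<in> B" for p
      proof -
        obtain q where "q \<in> B" "q \<noteq> p" using two by blast
        moreover have "\<not> (\<exists>p\<in>P. p < J)" using blocks(2) by (auto simp: not_less)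
        moreover have "same_block J p q"
          using that \<open>q \<in> B\<close> blocks(2) mem[of p] mem[of q] by (simp add: same_block_def)
        ultimately show ?thesis using good that mem[of p] mem[of q] by (metis (no_types, lifting))
      qed
      obtain p where p: "p \<in> B" using Bne by blast
      obtain c e where ce: "(c, e) \<in> S" "p \<in> edge J (c, e)" using BQ[OF p] by auto
      have "c = b" using edge_block[OF S[OF ce(1)] ce(2)] p mem by blast
      have e4: "e < 4" using S ce by blast
      have unique: "e' = e" if "(b, e') \<in> S" for e'
        using inj_onD[OF inj, of "(b, e')" "(c, e)"] ce(1) that \<open>c = b\<close> by simp
      have "B \<subseteq> edge J (b, e)"
      proof
        fix q assume q: "q \<in> B"
        obtain c' e' where ce': "(c', e') \<in> S" "q \<in> edge J (c', e')" using BQ[OF q] by auto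
        have "c' = b" using edge_block[OF S[OF ce'(1)] ce'(2)] q mem by blast
        then show "q \<in> edge J (b, e)" using unique ce' by auto
      qed
      moreover have "card B \<ge> 2"
      proof -
        obtain q where "q \<in> B" "q \<noteq> p" using two by blast
        then have "card {p, q} \<le> card B" using p Bfin by (intro card_mono) auto
        then show ?thesis using \<open>q \<noteq> p\<close> by simp
      qed
      ultimately have Be: "B = edge J (b, e)"
        using card_edge[OF e4] finite_edge[OF e4] by (metis card_seteq)
      \<comment> \<open>The orientation of \<open>b\<close> changes exactly when the edge contains
        role 2, that is for \<open>e = 1\<close> and \<open>e = 2\<close>.\<close>
      have t': "b \<in> t' \<longleftrightarrow> (b \<in> t \<longleftrightarrow> e \<noteq> 1 \<and> e \<noteq> 2)"
      proof -
        have "(b, k) \<in> S \<longleftrightarrow> k = e" for k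
          using unique[of k] ce(1) \<open>c = b\<close> by blast
        then show ?thesis unfolding t'_def by auto
      qed
      note rs = prio_pos[of 0, simplified] prio_pos[of "Suc 0", simplified]
        prio_pos[of 2, simplified] prio_pos[of 3, simplified]
      note vs = pos_value_pos[of 0, simplified] pos_value_pos[of "Suc 0", simplified]
        pos_value_pos[of 2, simplified] pos_value_pos[of 3, simplified]
      \<comment> \<open>Finite check: reversing the block negates the value of the list on each of
        the four edges, which cancels the flip on the two containing role 2.\<close>
      show ?thesis
        using less_4_cases[OF e4]
        by (elim disjE)
          (auto simp: no_val_def y flip Be t' rs vs min_def doubleton_eq_iff)
    qed
  qed
  then show ?thesis by (simp add: t'_def)
qed

section \<open>Adaptive queries\<close>

primrec all_queries :: "(point \<Rightarrow> bool) \<Rightarrow> det_alg \<Rightarrow> (point \<Rightarrow> bool) \<Rightarrow> point list \<Rightarrow> bool" where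
  "all_queries G (Output b) f S = True"
| "all_queries G (Query x k) f S = (G x \<and> all_queries G (k (f x)) f S)"
| "all_queries G (Sample k) f S = all_queries G (k (hd S)) f (tl S)"

text \<open>While the oracles agree on the queries of the branch followed with \<open>f\<close>, the
  oracle \<open>g\<close> selects the same branch; nothing is required off that branch.\<close>

lemma run_eq_if_all_queries:
  assumes "all_queries G A f S" "\<And>x. G x \<Longrightarrow> f x = g x"
  shows "run A f S = run A g S"
  using assms(1) by (induction A arbitrary: S) (auto simp: assms(2))

text \<open>\<open>Q\<close> stands for the positions on sampled edges. Pairs inside
  \<open>Q\<close> are exempt because the samples reveal them anyway, and the orientation of their
  block can compensate for the flip.\<close>

definition isolated :: "nat \<Rightarrow> nat set \<Rightarrow> (nat \<Rightarrow> nat) \<Rightarrow> nat set \<Rightarrow> bool" where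
  "isolated J Q \<rho> K \<longleftrightarrow>
     (\<forall>i\<in>K. \<forall>j\<in>K. i \<noteq> j \<longrightarrow> same_block J (\<rho> i) (\<rho> j) \<longrightarrow> \<rho> i \<in> Q \<and> \<rho> j \<in> Q)"

lemma isolated_mono: "isolated J Q \<rho> K' \<Longrightarrow> K \<subseteq> K' \<Longrightarrow> isolated J Q \<rho> K"
  unfolding isolated_def by blast

lemma isolated_agreeing:
  assumes "\<rho> \<in> agreeing n \<rho>\<^sub>0 K"
  shows "isolated J Q \<rho> K \<longleftrightarrow> isolated J Q \<rho>\<^sub>0 K"
  using assms by (simp add: isolated_def agreeing_def)

definition good_query :: "nat \<Rightarrow> nat set \<Rightarrow> (nat \<Rightarrow> nat) \<Rightarrow> point \<Rightarrow> bool" where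
  "good_query J Q \<rho> x \<longleftrightarrow> (\<exists>i\<in>supp x. \<rho> i < J) \<or> isolated J Q \<rho> (supp x)"

definition yes_fun :: "nat \<Rightarrow> (nat \<Rightarrow> nat) \<Rightarrow> nat set \<Rightarrow> point \<Rightarrow> bool" where
  "yes_fun J \<rho> t x = yes_val J t (\<rho> ` supp x)"

lemma same_block_sym: "same_block J p q \<longleftrightarrow> same_block J q p"
  by (auto simp: same_block_def)

lemma card_same_block: "finite {q. same_block J q p} \<and> card {q. same_block J q p} \<le> 4"
proof -
  have sub: "{q. same_block J q p} \<subseteq> {J + 4 * block J p..<J + 4 * block J p + 4}"
  proof
    fix q assume "q \<in> {q. same_block J q p}"
    then have "J \<le> q" "block J q = block J p" by (auto simp: same_block_def)
    then show "q \<in> {J + 4 * block J p..<J + 4 * block J p + 4}"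
      by (cases q J rule: pos_cases) auto
  qed
  from card_mono[OF _ sub] finite_subset[OF sub] show ?thesis by simp
qed

text \<open>Expose the value at \<open>j\<close> first, unless it is known already; its block has
  only four positions, and the still free coordinate \<open>i\<close> hits each with probability at
  most \<open>1 / (n - \<kappa>)\<close>.\<close>

lemma card_collision:
  assumes \<rho>\<^sub>0: "\<rho>\<^sub>0 permutes {..<n}" and K: "K \<subseteq> {..<n}"
    and i: "i < n" "i \<notin> K" and j: "j < n" "j \<noteq> i" and \<kappa>: "card (insert j K) \<le> \<kappa>" "\<kappa> < n"
  shows "real (card {\<rho> \<in> agreeing n \<rho>\<^sub>0 K. same_block J (\<rho> i) (\<rho> j)})
     \<le> 4 / (real n - real \<kappa>) * real (card (agreeing n \<rho>\<^sub>0 K))"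
proof (rule card_agreeing_by_exposure[where K' = "insert j K"])
  fix \<rho>\<^sub>1 assume r1: "\<rho>\<^sub>1 \<in> agreeing n \<rho>\<^sub>0 K"
  define W where "W = {q. same_block J q (\<rho>\<^sub>1 j)}"
  let ?C = "agreeing n \<rho>\<^sub>1 (insert j K)"
  have W: "finite W" "card W \<le> 4" using card_same_block by (auto simp: W_def)
  have eq: "{\<rho> \<in> ?C. same_block J (\<rho> i) (\<rho> j)} = {\<rho> \<in> ?C. \<rho> i \<in> W}"
    by (auto simp: W_def agreeing_def)
  have "card {\<rho> \<in> ?C. \<rho> i \<in> W} * (n - card (insert j K)) \<le> card W * card ?C"
    by (rule card_agreeing_value_in) (use r1 K i j W in \<open>auto simp: agreeing_def\<close>)
  also have "\<dots> \<le> 4 * card ?C" using W by simp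
  finally have "card {\<rho> \<in> ?C. \<rho> i \<in> W} * (n - card (insert j K)) \<le> 4 * card ?C" .
  moreover have "card {\<rho> \<in> ?C. \<rho> i \<in> W} * (n - \<kappa>) \<le> card {\<rho> \<in> ?C. \<rho> i \<in> W} * (n - card (insert j K))"
    using \<kappa> by (intro mult_le_mono2) simp
  ultimately have "card {\<rho> \<in> ?C. \<rho> i \<in> W} * (n - \<kappa>) \<le> 4 * card ?C" by linarith
  then have "real (card {\<rho> \<in> ?C. \<rho> i \<in> W}) * (real n - real \<kappa>) \<le> 4 * real (card ?C)"
    using \<kappa>(2) by (metis (no_types, lifting) less_imp_le of_nat_diff of_nat_le_iff of_nat_mult of_nat_numeral)
  then show "real (card {\<rho> \<in> ?C. same_block J (\<rho> i) (\<rho> j)}) \<le> 4 / (real n - real \<kappa>) * real (card ?C)"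
    unfolding eq using \<kappa>(2) by (simp add: field_simps)
qed auto

text \<open>Union bound over pairs with at least one new coordinate: pairs inside \<open>K\<close>
  are harmless by assumption, which leaves at most \<open>L * \<kappa>\<close> pairs for
  \<open>card_collision\<close>.\<close>

lemma card_not_isolated:
  assumes \<rho>\<^sub>0: "\<rho>\<^sub>0 permutes {..<n}" and K: "K \<subseteq> {..<n}" and X: "X \<subseteq> {..<n}"
    and iso: "isolated J Q \<rho>\<^sub>0 K" and L: "card (X - K) \<le> L" and \<kappa>: "card (K \<union> X) \<le> \<kappa>" "\<kappa> < n"
  shows "real (card {\<rho> \<in> agreeing n \<rho>\<^sub>0 K. \<not> isolated J Q \<rho> (K \<union> X)})
     \<le> (real L * real \<kappa> * (4 / (real n - real \<kappa>))) * real (card (agreeing n \<rho>\<^sub>0 K))"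
proof -
  let ?C = "agreeing n \<rho>\<^sub>0 K"
  define I where "I = {(i, j) \<in> (X - K) \<times> (K \<union> X). i \<noteq> j}"
  have fin: "finite K" "finite X" using K X finite_subset by auto
  have fI: "finite I" by (rule finite_subset[of _ "(X - K) \<times> (K \<union> X)"]) (use fin in \<open>auto simp: I_def\<close>)
  have "card I \<le> card ((X - K) \<times> (K \<union> X))"
    by (rule card_mono) (use fin in \<open>auto simp: I_def\<close>)
  also have "\<dots> \<le> L * \<kappa>" unfolding card_cartesian_product by (rule mult_le_mono[OF L \<kappa>(1)])
  finally have cI: "real (card I) \<le> real L * real \<kappa>" by (simp flip: of_nat_mult)
  have sub: "{\<rho> \<in> ?C. \<not> isolated J Q \<rho> (K \<union> X)}
      \<subseteq> (\<Union>(i, j)\<in>I. {\<rho> \<in> ?C. same_block J (\<rho> i) (\<rho> j)})"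
  proof
    fix \<rho> assume \<rho>: "\<rho> \<in> {\<rho> \<in> ?C. \<not> isolated J Q \<rho> (K \<union> X)}"
    then obtain i j where ij: "i \<in> K \<union> X" "j \<in> K \<union> X" "i \<noteq> j" "same_block J (\<rho> i) (\<rho> j)"
        "\<not> (\<rho> i \<in> Q \<and> \<rho> j \<in> Q)"
      unfolding isolated_def by blast
    have "\<not> (i \<in> K \<and> j \<in> K)"
      using isolated_agreeing[of \<rho> n \<rho>\<^sub>0 K J Q] \<rho> iso ij unfolding isolated_def by blast
    then have "(i, j) \<in> I \<or> (j, i) \<in> I" using ij by (auto simp: I_def)
    moreover have "same_block J (\<rho> j) (\<rho> i)" using ij same_block_sym by blast
    ultimately show "\<rho> \<in> (\<Union>(i, j)\<in>I. {\<rho> \<in> ?C. same_block J (\<rho> i) (\<rho> j)})"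
      using \<rho> ij by blast
  qed
  have "card {\<rho> \<in> ?C. \<not> isolated J Q \<rho> (K \<union> X)}
      \<le> card (\<Union>(i, j)\<in>I. {\<rho> \<in> ?C. same_block J (\<rho> i) (\<rho> j)})"
    by (rule card_mono[OF _ sub]) (use fI in auto)
  also have "\<dots> \<le> (\<Sum>(i, j)\<in>I. card {\<rho> \<in> ?C. same_block J (\<rho> i) (\<rho> j)})"
    using card_UN_le[OF fI, of "\<lambda>(i, j). {\<rho> \<in> ?C. same_block J (\<rho> i) (\<rho> j)}"]
    by (simp add: case_prod_beta)
  finally have "real (card {\<rho> \<in> ?C. \<not> isolated J Q \<rho> (K \<union> X)})
      \<le> (\<Sum>(i, j)\<in>I. real (card {\<rho> \<in> ?C. same_block J (\<rho> i) (\<rho> j)}))"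
    by (simp add: case_prod_beta flip: of_nat_sum)
  also have "\<dots> \<le> (\<Sum>(i, j)\<in>I. 4 / (real n - real \<kappa>) * real (card ?C))"
  proof (rule sum_mono, clarify)
    fix i j assume ij: "(i, j) \<in> I"
    have "card (insert j K) \<le> card (K \<union> X)"
      by (rule card_mono) (use fin ij in \<open>auto simp: I_def\<close>)
    then show "real (card {\<rho> \<in> ?C. same_block J (\<rho> i) (\<rho> j)}) \<le> 4 / (real n - real \<kappa>) * real (card ?C)"
      by (intro card_collision) (use ij K X \<rho>\<^sub>0 \<kappa> in \<open>auto simp: I_def\<close>)
  qed
  also have "\<dots> = real (card I) * (4 / (real n - real \<kappa>) * real (card ?C))"
    by simp
  also have "\<dots> \<le> (real L * real \<kappa>) * (4 / (real n - real \<kappa>) * real (card ?C))"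
    by (rule mult_right_mono[OF cI]) (use \<kappa> in auto)
  finally show ?thesis by (simp add: mult_ac)
qed

text \<open>A query with more than \<open>L\<close> unexposed coordinates very likely meets a junk position, so
  its answer carries no information and no conditioning is needed; a query with at most \<open>L\<close>
  unexposed coordinates is answered after exposing all of them.\<close>

lemma card_bad_queries:
  fixes J n L \<kappa> :: nat
  defines "\<delta> \<equiv> real L * real \<kappa> * (4 / (real n - real \<kappa>)) + (2 / 3) ^ L"
  assumes "bounded_alg n m M A"
    and "J \<le> n" and \<kappa>: "\<kappa> < n" and junk: "3 * (real n - real J) \<le> 2 * (real n - real \<kappa> - real L)"
    and "\<rho>\<^sub>0 permutes {..<n}" and "K \<subseteq> {..<n}" and "isolated J Q \<rho>\<^sub>0 K"
    and "card K + M * L \<le> \<kappa>" and "m \<le> length S" and "set S \<subseteq> cube n"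
  shows "real (card {\<rho> \<in> agreeing n \<rho>\<^sub>0 K. \<not> all_queries (good_query J Q \<rho>) A (yes_fun J \<rho> t) S})
     \<le> real M * \<delta> * real (card (agreeing n \<rho>\<^sub>0 K))"
  using assms(2,6-)
proof (induction arbitrary: K \<rho>\<^sub>0 S rule: bounded_alg.induct)
  case (1 m M b)
  have "0 \<le> \<delta>" using \<kappa> by (simp add: \<delta>_def)
  then show ?case by simp
next
  case (3 m M k)
  \<comment> \<open>The bound on the number of samples rules out an empty list here.\<close>
  then obtain s S' where S: "S = s # S'" by (cases S) auto
  with 3 show ?case by simp
next
  case (2 x m M k)
  let ?C = "agreeing n \<rho>\<^sub>0 K"
  let ?bad = "\<lambda>A \<rho>. \<not> all_queries (good_query J Q \<rho>) A (yes_fun J \<rho> t) S"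
  define \<alpha> where "\<alpha> = real L * real \<kappa> * (4 / (real n - real \<kappa>))"
  have \<alpha>: "0 \<le> \<alpha>" using \<kappa> by (simp add: \<alpha>_def)
  have \<delta>: "\<delta> = \<alpha> + (2 / 3) ^ L" by (simp add: \<delta>_def \<alpha>_def)
  have X: "supp x \<subseteq> {..<n}" using supp_subset_cube 2 by blast
  have fK: "finite K" using 2 finite_subset by blast
  have KL: "card K + L + M * L \<le> \<kappa>" using 2 by simp
  show ?case
  proof (cases "card (supp x - K) \<le> L")
    case True
    let ?K' = "K \<union> supp x"
    have "card ?K' = card K + card (supp x - K)"
      using card_Un_disjoint[of K "supp x - K"] fK by (simp add: Un_Diff_cancel)
    then have cK': "card ?K' \<le> card K + L" using True by simp
    \<comment> \<open>Once the values on the enlarged set are exposed, the answer is determined, so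
      the induction hypothesis is needed only for the one subtree it selects.\<close>
    have step: "real (card {\<rho> \<in> ?C. isolated J Q \<rho> ?K' \<and> ?bad (Query x k) \<rho>}) \<le> real M * \<delta> * real (card ?C)"
    proof (rule card_agreeing_by_exposure[where K' = ?K'])
      fix \<rho>\<^sub>1 assume r1: "\<rho>\<^sub>1 \<in> ?C"
      let ?C1 = "agreeing n \<rho>\<^sub>1 ?K'"
      show "real (card {\<rho> \<in> ?C1. isolated J Q \<rho> ?K' \<and> ?bad (Query x k) \<rho>}) \<le> real M * \<delta> * real (card ?C1)"
      proof (cases "isolated J Q \<rho>\<^sub>1 ?K'")
        case False
        then have none: "{\<rho> \<in> ?C1. isolated J Q \<rho> ?K' \<and> ?bad (Query x k) \<rho>} = {}"
          using isolated_agreeing by blast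
        show ?thesis unfolding none using \<alpha> by (simp add: \<delta>)
      next
        case iso: True
        have "{\<rho> \<in> ?C1. isolated J Q \<rho> ?K' \<and> ?bad (Query x k) \<rho>}
            \<subseteq> {\<rho> \<in> ?C1. ?bad (k (yes_fun J \<rho>\<^sub>1 t x)) \<rho>}"
        proof safe
          fix \<rho> assume \<rho>: "\<rho> \<in> ?C1" "isolated J Q \<rho> ?K'" "?bad (Query x k) \<rho>"
            and a: "all_queries (good_query J Q \<rho>) (k (yes_fun J \<rho>\<^sub>1 t x)) (yes_fun J \<rho> t) S"
          have "good_query J Q \<rho> x"
            using isolated_mono[OF \<rho>(2), of "supp x"] by (simp add: good_query_def)
          moreover have "\<rho> ` supp x = \<rho>\<^sub>1 ` supp x"
            using \<rho>(1) by (intro image_cong) (auto simp: agreeing_def)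
          ultimately show False using \<rho>(3) a by (simp add: yes_fun_def)
        qed
        then have "card {\<rho> \<in> ?C1. isolated J Q \<rho> ?K' \<and> ?bad (Query x k) \<rho>}
            \<le> card {\<rho> \<in> ?C1. ?bad (k (yes_fun J \<rho>\<^sub>1 t x)) \<rho>}"
          by (intro card_mono) auto
        also have "real (card {\<rho> \<in> ?C1. ?bad (k (yes_fun J \<rho>\<^sub>1 t x)) \<rho>}) \<le> real M * \<delta> * real (card ?C1)"
        proof (rule 2)
          show "\<rho>\<^sub>1 permutes {..<n}" using r1 by (simp add: agreeing_def)
          show "?K' \<subseteq> {..<n}" using 2 X by simp
          show "card ?K' + M * L \<le> \<kappa>" using cK' KL by simp
        qed (use 2 iso in auto)
        finally show ?thesis by simp
      qed
    qed auto
    have "{\<rho> \<in> ?C. ?bad (Query x k) \<rho>} \<subseteq> {\<rho> \<in> ?C. \<not> isolated J Q \<rho> ?K'}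
        \<union> {\<rho> \<in> ?C. isolated J Q \<rho> ?K' \<and> ?bad (Query x k) \<rho>}" by blast
    then have "card {\<rho> \<in> ?C. ?bad (Query x k) \<rho>} \<le> card ({\<rho> \<in> ?C. \<not> isolated J Q \<rho> ?K'}
        \<union> {\<rho> \<in> ?C. isolated J Q \<rho> ?K' \<and> ?bad (Query x k) \<rho>})"
      by (intro card_mono) auto
    also have "\<dots> \<le> card {\<rho> \<in> ?C. \<not> isolated J Q \<rho> ?K'}
        + card {\<rho> \<in> ?C. isolated J Q \<rho> ?K' \<and> ?bad (Query x k) \<rho>}" by (rule card_Un_le)
    finally have "real (card {\<rho> \<in> ?C. ?bad (Query x k) \<rho>}) \<le> real (card {\<rho> \<in> ?C. \<not> isolated J Q \<rho> ?K'})
        + real (card {\<rho> \<in> ?C. isolated J Q \<rho> ?K' \<and> ?bad (Query x k) \<rho>})" by linarith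
    moreover have "real (card {\<rho> \<in> ?C. \<not> isolated J Q \<rho> ?K'}) \<le> \<alpha> * real (card ?C)"
      unfolding \<alpha>_def by (rule card_not_isolated) (use 2 X True cK' KL \<kappa> in auto)
    moreover have "\<alpha> * real (card ?C) \<le> \<delta> * real (card ?C)"
      by (rule mult_right_mono) (auto simp: \<delta>)
    ultimately have "real (card {\<rho> \<in> ?C. ?bad (Query x k) \<rho>})
        \<le> \<delta> * real (card ?C) + real M * \<delta> * real (card ?C)"
      using step by linarith
    then show ?thesis by (simp add: distrib_right)
  next
    case False
    \<comment> \<open>Testing just \<open>L\<close> of the unexposed coordinates for junk gives the
      error \<open>(2 / 3) ^ L\<close>.\<close>
    then obtain Y where Y: "Y \<subseteq> supp x - K" "card Y = L" "finite Y"
      using obtain_subset_with_card_n[of L "supp x - K"] by (metis nat_le_linear)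
    \<comment> \<open>Unless all of \<open>Y\<close> avoids junk, the answer is 1 and the run
      continues in \<open>k True\<close>. No value is exposed, so the induction hypothesis is used
      with the same \<open>K\<close>.\<close>
    have "{\<rho> \<in> ?C. ?bad (Query x k) \<rho>} \<subseteq> {\<rho> \<in> ?C. \<rho> ` Y \<subseteq> {J..<n}} \<union> {\<rho> \<in> ?C. ?bad (k True) \<rho>}"
    proof safe
      fix \<rho> i assume \<rho>: "\<rho> \<in> ?C" "?bad (Query x k) \<rho>" "i \<in> Y"
        and a: "all_queries (good_query J Q \<rho>) (k True) (yes_fun J \<rho> t) S"
      have "\<rho> permutes {..<n}" using \<rho> by (simp add: agreeing_def)
      then have "\<rho> i < n" using permutes_in_image[of \<rho> "{..<n}" i] \<rho>(3) Y X by auto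
      moreover have "\<not> \<rho> i < J"
      proof
        assume "\<rho> i < J"
        moreover have "i \<in> supp x" using \<rho> Y by blast
        ultimately have "good_query J Q \<rho> x" "yes_fun J \<rho> t x"
          using yes_val_junk[of "\<rho> ` supp x" "\<rho> i" J t] by (auto simp: good_query_def yes_fun_def)
        then show False using \<rho>(2) a by simp
      qed
      ultimately show "\<rho> i \<in> {J..<n}" by simp
    qed
    then have "card {\<rho> \<in> ?C. ?bad (Query x k) \<rho>}
        \<le> card ({\<rho> \<in> ?C. \<rho> ` Y \<subseteq> {J..<n}} \<union> {\<rho> \<in> ?C. ?bad (k True) \<rho>})"
      by (intro card_mono) auto
    also have "\<dots> \<le> card {\<rho> \<in> ?C. \<rho> ` Y \<subseteq> {J..<n}} + card {\<rho> \<in> ?C. ?bad (k True) \<rho>}"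
      by (rule card_Un_le)
    finally have "real (card {\<rho> \<in> ?C. ?bad (Query x k) \<rho>})
        \<le> real (card {\<rho> \<in> ?C. \<rho> ` Y \<subseteq> {J..<n}}) + real (card {\<rho> \<in> ?C. ?bad (k True) \<rho>})" by linarith
    moreover have "real (card {\<rho> \<in> ?C. \<rho> ` Y \<subseteq> {J..<n}}) \<le> (2 / 3) ^ card Y * real (card ?C)"
    proof (rule card_agreeing_image_subset)
      \<comment> \<open>The ratio 2 / 3 compares the \<open>n - J\<close> positions outside the junk
        with the at least \<open>n - \<kappa> - L\<close> values still free.\<close>
      have "real (card K) \<le> real \<kappa>" using KL by simp
      then show "real (card {J..<n}) \<le> 2 / 3 * (real n - real (card K) - real (card Y))"
        using junk \<open>J \<le> n\<close> Y by (simp add: of_nat_diff)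
    qed (use 2 Y X in auto)
    moreover have "(2 / 3) ^ card Y * real (card ?C) \<le> \<delta> * real (card ?C)"
      by (rule mult_right_mono) (use \<alpha> Y in \<open>auto simp: \<delta>\<close>)
    moreover have "real (card {\<rho> \<in> ?C. ?bad (k True) \<rho>}) \<le> real M * \<delta> * real (card ?C)"
      by (rule 2) (use 2 KL in auto)
    ultimately have "real (card {\<rho> \<in> ?C. ?bad (Query x k) \<rho>})
        \<le> \<delta> * real (card ?C) + real M * \<delta> * real (card ?C)" by linarith
    then show ?thesis by (simp add: distrib_right)
  qed
qed

section \<open>The coupling\<close>

definition no_fun :: "nat \<Rightarrow> (nat \<Rightarrow> nat) \<Rightarrow> nat set \<Rightarrow> point \<Rightarrow> bool" where
  "no_fun J \<rho> t x = no_val J t (\<rho> ` supp x)"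

definition edge_point :: "nat \<Rightarrow> nat \<Rightarrow> (nat \<Rightarrow> nat) \<Rightarrow> nat \<times> nat \<Rightarrow> point" where
  "edge_point n J \<rho> s = map (\<lambda>i. \<rho> i \<in> edge J s) [0..<n]"

lemma edge_point_cube [simp]: "edge_point n J \<rho> s \<in> cube n"
  by (simp add: edge_point_def cube_def)

lemma nth_edge_point: "i < n \<Longrightarrow> edge_point n J \<rho> s ! i \<longleftrightarrow> \<rho> i \<in> edge J s"
  by (simp add: edge_point_def)

lemma image_supp_edge_point:
  assumes "\<rho> permutes {..<n}" "edge J s \<subseteq> {..<n}"
  shows "\<rho> ` supp (edge_point n J \<rho> s) = edge J s"
proof -
  have "supp (edge_point n J \<rho> s) = {i. i < n \<and> \<rho> i \<in> edge J s}"
    by (auto simp: supp_def edge_point_def)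
  moreover have "p \<in> \<rho> ` {i. i < n \<and> \<rho> i \<in> edge J s}" if "p \<in> edge J s" for p
  proof -
    have "p \<in> \<rho> ` {..<n}" using that assms permutes_image[OF assms(1)] by blast
    then show ?thesis using that by auto
  qed
  ultimately show ?thesis by auto
qed

text \<open>Coordinate \<open>i\<close> sits at index \<open>\<kappa> i\<close> of the list, where
  \<kappa> is \<open>prio\<close> after \<rho>; the permutation required by the definition is
  therefore the inverse of \<kappa>.\<close>

lemma monotone_decision_list_yes_fun:
  assumes \<rho>: "\<rho> permutes {..<n}" and n: "J + 4 * N = n"
  shows "monotone_decision_list n (yes_fun J \<rho> t)"
proof -
  define \<kappa> where "\<kappa> = (\<lambda>p. if p < n then prio J t p else p) \<circ> \<rho>"
  \<comment> \<open>The conjunct \<open>j < n\<close> makes the default value at index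
    \<open>n\<close> false, matching the empty case of \<open>yes_val\<close>.\<close>
  define \<nu> where "\<nu> j \<longleftrightarrow> j < n \<and> pos_value J j" for j
  have \<kappa>: "\<kappa> permutes {..<n}"
    unfolding \<kappa>_def by (rule permutes_compose[OF \<rho> prio_permutes[OF n]])
  have "yes_fun J \<rho> t x = (if \<exists>j<n. x ! inv \<kappa> j then \<nu> (LEAST j. j < n \<and> x ! inv \<kappa> j) else \<nu> n)"
    if x: "x \<in> cube n" for x
  proof -
    have len: "length x = n" using x by (simp add: cube_def)
    have \<rho>lt: "\<rho> i < n" if "i < n" for i using permutes_in_image[OF \<rho>, of i] that by simp
    have T: "{j. j < n \<and> x ! inv \<kappa> j} = prio J t ` \<rho> ` supp x" (is "?T = _")
    proof -
      have "?T = \<kappa> ` supp x"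
      proof safe
        fix j assume j: "j < n" "x ! inv \<kappa> j"
        have "inv \<kappa> j < n" using permutes_in_image[OF permutes_inv[OF \<kappa>], of j] j by simp
        then have "inv \<kappa> j \<in> supp x" using j len by (simp add: supp_def)
        moreover have "\<kappa> (inv \<kappa> j) = j" by (rule permutes_inverses(1)[OF \<kappa>])
        ultimately show "j \<in> \<kappa> ` supp x" by (metis imageI)
      next
        fix i assume i: "i \<in> supp x"
        then have "i < n" using len by (simp add: supp_def)
        then show "\<kappa> i < n" using permutes_in_image[OF \<kappa>, of i] by simp
        show "x ! inv \<kappa> (\<kappa> i)" using i by (simp add: permutes_inverses(2)[OF \<kappa>] supp_def)
      qed
      also have "\<kappa> ` supp x = prio J t ` \<rho> ` supp x"
        unfolding \<kappa>_def image_image comp_def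
        by (rule image_cong) (use \<rho>lt len in \<open>auto simp: supp_def\<close>)
      finally show ?thesis .
    qed
    show ?thesis
    proof (cases "supp x = {}")
      case True
      then have "\<not> (\<exists>j<n. x ! inv \<kappa> j)" using T by blast
      then show ?thesis using True by (subst if_not_P) (auto simp: yes_fun_def yes_val_def \<nu>_def)
    next
      case False
      then have ex: "\<exists>j<n. x ! inv \<kappa> j" using T by blast
      have least: "(LEAST j. j < n \<and> x ! inv \<kappa> j) = Min (prio J t ` \<rho> ` supp x)"
        using Least_Min[of "\<lambda>j. j < n \<and> x ! inv \<kappa> j"] ex T by simp
      have "Min (prio J t ` \<rho> ` supp x) \<in> prio J t ` \<rho> ` supp x"
        by (rule Min_in) (use False in auto)
      then have "Min (prio J t ` \<rho> ` supp x) < n" using T by blast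
      with False show ?thesis unfolding if_P[OF ex] least by (simp add: yes_fun_def yes_val_def \<nu>_def)
    qed
  qed
  then show ?thesis
    unfolding monotone_decision_list_def using permutes_inv[OF \<kappa>] by blast
qed

section \<open>Values on edges and the distance from linear thresholds\<close>

lemma yes_val_edge:
  assumes "e < 4"
  shows "yes_val J t (edge J (b, e)) \<longleftrightarrow> (b \<in> t) = (e = 1 \<or> e = 3)"
proof -
  note ps = prio_pos[of 0, simplified] prio_pos[of "Suc 0", simplified]
    prio_pos[of 2, simplified] prio_pos[of 3, simplified]
  note vs = pos_value_pos[of 0, simplified] pos_value_pos[of "Suc 0", simplified]
    pos_value_pos[of 2, simplified] pos_value_pos[of 3, simplified]
  show ?thesis using less_4_cases[OF assms]
    by (elim disjE) (auto simp: yes_val_def ps vs min_def)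
qed

text \<open>Flipping the edges with role 2 makes the value depend only on the matching. This follows
  from \<open>no_val_eq_yes_val\<close> with the single sample \<open>(b, e)\<close>, applied to
  \<open>sym_diff t T\<close> since the symmetric difference with \<open>T\<close> is an
  involution.\<close>

lemma no_val_edge:
  assumes "e < 4"
  shows "no_val J t (edge J (b, e)) \<longleftrightarrow> (b \<in> t) \<noteq> (e < 2)"
proof -
  define T where "T = {c. (c, 1) \<in> {(b, e)} \<or> (c, 2) \<in> {(b, e)}}"
  have "no_val J (sym_diff (sym_diff t T) T) (edge J (b, e)) = yes_val J (sym_diff t T) (edge J (b, e))"
    unfolding T_def by (rule no_val_eq_yes_val) (use finite_edge assms in auto)
  moreover have "sym_diff (sym_diff t T) T = t" by auto
  ultimately have "no_val J t (edge J (b, e)) \<longleftrightarrow> (b \<in> sym_diff t T) = (e = 1 \<or> e = 3)"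
    by (simp only: yes_val_edge[OF assms])
  moreover have "b \<in> T \<longleftrightarrow> e = 1 \<or> e = 2" by (auto simp: T_def)
  moreover have "e < 2 \<longleftrightarrow> e = 0 \<or> e = 1" by auto
  ultimately show ?thesis using less_4_cases[OF assms] by (simp only: Un_iff Diff_iff) auto
qed

text \<open>The two edges of one matching would have weight at least \<theta> and the two of the
  other weight below \<theta>, yet both matchings cover each role once and so have the same total
  weight.\<close>

lemma linear_threshold_errs_on_block:
  assumes \<rho>: "\<rho> permutes {..<n}" and n: "J + 4 * N = n" and b: "b < N" and g: "linear_threshold n g"
  shows "\<exists>e<4. no_fun J \<rho> t (edge_point n J \<rho> (b, e)) \<noteq> g (edge_point n J \<rho> (b, e))"
proof (rule ccontr)
  assume "\<not> ?thesis"
  then have eq: "g (edge_point n J \<rho> (b, e)) = no_fun J \<rho> t (edge_point n J \<rho> (b, e))" if "e < 4" for e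
    using that by blast
  obtain w \<theta> where w: "\<And>x. x \<in> cube n \<Longrightarrow> g x \<longleftrightarrow> (\<Sum>i<n. w i * of_bool (x ! i)) \<ge> (\<theta> :: real)"
    using g unfolding linear_threshold_def by blast
  define s where "s e = (\<Sum>i<n. w i * of_bool (\<rho> i \<in> edge J (b, e)))" for e
  have gs: "g (edge_point n J \<rho> (b, e)) \<longleftrightarrow> s e \<ge> \<theta>" for e
    unfolding s_def by (subst w) (auto simp: nth_edge_point)
  have sub: "edge J (b, e) \<subseteq> {..<n}" if "e < 4" for e
    using less_4_cases[OF that] n b by auto
  have val: "s e \<ge> \<theta> \<longleftrightarrow> (b \<in> t) \<noteq> (e < 2)" if "e < 4" for e
    using eq[OF that] gs[of e]
    by (simp add: no_fun_def image_supp_edge_point[OF \<rho> sub[OF that]] no_val_edge[OF that])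
  have "s 0 + s 1 = s 2 + s 3"
    unfolding s_def sum.distrib[symmetric] by (rule sum.cong) (auto simp: of_bool_def)
  then show False
    using val[of 0] val[of 1] val[of 2] val[of 3] by (cases "b \<in> t") auto
qed

text \<open>One erring edge per block gives \<open>N\<close> errors among \<open>4 * N\<close>
  equally likely edges.\<close>

lemma far_no_fun:
  assumes \<rho>: "\<rho> permutes {..<n}" and n: "J + 4 * N = n" and N: "0 < N" and \<epsilon>: "\<epsilon> \<le> 1 / 4"
  shows "far_from_linear_threshold \<epsilon> n
     (map_pmf (edge_point n J \<rho>) (pmf_of_set ({..<N} \<times> {..<4}))) (no_fun J \<rho> t)"
  unfolding far_from_linear_threshold_def
proof (intro allI impI)
  fix g assume "linear_threshold n g"
  then have "\<forall>b\<in>{..<N}. \<exists>e<4. no_fun J \<rho> t (edge_point n J \<rho> (b, e)) \<noteq> g (edge_point n J \<rho> (b, e))"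
    using linear_threshold_errs_on_block[OF \<rho> n] by blast
  then obtain err where err: "\<And>b. b < N \<Longrightarrow> err b < 4 \<and>
      no_fun J \<rho> t (edge_point n J \<rho> (b, err b)) \<noteq> g (edge_point n J \<rho> (b, err b))"
    by (metis lessThan_iff)
  let ?E = "{..<N} \<times> {..<4::nat}"
  let ?B = "edge_point n J \<rho> -` {x. no_fun J \<rho> t x \<noteq> g x}"
  have "card ((\<lambda>b. (b, err b)) ` {..<N}) \<le> card (?E \<inter> ?B)"
    by (rule card_mono) (use err in auto)
  moreover have "card ((\<lambda>b. (b, err b)) ` {..<N}) = N"
    by (subst card_image) (auto intro: inj_onI)
  ultimately have "N \<le> card (?E \<inter> ?B)" by simp
  then have "1 / 4 \<le> real (card (?E \<inter> ?B)) / real (card ?E)"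
    using N by (simp add: field_simps)
  also have "\<dots> = measure_pmf.prob (pmf_of_set ?E) ?B"
    by (rule measure_pmf_of_set[symmetric]) (use N in \<open>auto simp: lessThan_empty_iff\<close>)
  finally show "\<epsilon> \<le> measure_pmf.prob (map_pmf (edge_point n J \<rho>) (pmf_of_set ?E)) {x. no_fun J \<rho> t x \<noteq> g x}"
    using \<epsilon> by simp
qed

text \<open>The samples reveal at most which coordinates occupy the positions in \<open>Q\<close>.
  This exposed set depends on \<rho>, so the conditioning is on the graph of \<rho> over the
  preimage of \<open>Q\<close>. On each fibre the sample points are constant, at most
  \<open>2 * m\<close> coordinates are exposed, and these are isolated because their positions lie
  in \<open>Q\<close>.\<close>

lemma card_bad_given_samples:
  fixes J n L \<kappa> :: nat and S :: "(nat \<times> nat) list"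
  defines "\<delta> \<equiv> real L * real \<kappa> * (4 / (real n - real \<kappa>)) + (2 / 3) ^ L"
    and "Q \<equiv> \<Union>s\<in>set S. edge J s"
  assumes A: "bounded_alg n m M A" and n: "J + 4 * N = n"
    and \<kappa>: "\<kappa> < n" and junk: "12 * real N \<le> 2 * (real n - real \<kappa> - real L)"
    and S: "set S \<subseteq> {..<N} \<times> {..<4}" "length S = m" and mL: "2 * m + M * L \<le> \<kappa>"
  shows "real (card {\<rho>. \<rho> permutes {..<n} \<and>
       \<not> all_queries (good_query J Q \<rho>) A (yes_fun J \<rho> t) (map (edge_point n J \<rho>) S)})
     \<le> real M * \<delta> * real (card {\<rho>. \<rho> permutes {..<n}})"
proof -
  let ?P = "{\<rho>. \<rho> permutes {..<n}}"
  let ?bad = "\<lambda>\<rho>. \<not> all_queries (good_query J Q \<rho>) A (yes_fun J \<rho> t) (map (edge_point n J \<rho>) S)"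
  have Q: "finite Q" "card Q \<le> 2 * m"
  proof -
    have e: "finite (edge J s) \<and> card (edge J s) = 2" if "s \<in> set S" for s
      using S(1) that finite_edge card_edge by (cases s) auto
    then show "finite Q" by (auto simp: Q_def)
    have "card Q \<le> (\<Sum>s\<in>set S. card (edge J s))" unfolding Q_def by (rule card_UN_le) simp
    also have "\<dots> = 2 * card (set S)" using e by simp
    also have "\<dots> \<le> 2 * m" using card_length[of S] S by simp
    finally show "card Q \<le> 2 * m" .
  qed
  have "real (card {\<rho> \<in> ?P. ?bad \<rho>}) \<le> real M * \<delta> * real (card ?P)"
  proof (rule card_le_by_fibres[where \<phi> = "\<lambda>\<rho>. {(i, \<rho> i) |i. i < n \<and> \<rho> i \<in> Q}"])
    show "finite ?P" by (rule finite_permutations) simp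
  next
    fix \<rho>\<^sub>0 assume "\<rho>\<^sub>0 \<in> ?P"
    then have \<rho>\<^sub>0: "\<rho>\<^sub>0 permutes {..<n}" by simp
    define K where "K = {i. i < n \<and> \<rho>\<^sub>0 i \<in> Q}"
    have fibre: "{(i, \<rho> i) |i. i < n \<and> \<rho> i \<in> Q} = {(i, \<rho>\<^sub>0 i) |i. i < n \<and> \<rho>\<^sub>0 i \<in> Q} \<longleftrightarrow> (\<forall>i\<in>K. \<rho> i = \<rho>\<^sub>0 i)"
      if \<rho>: "\<rho> permutes {..<n}" for \<rho>
    proof
      assume eq: "{(i, \<rho> i) |i. i < n \<and> \<rho> i \<in> Q} = {(i, \<rho>\<^sub>0 i) |i. i < n \<and> \<rho>\<^sub>0 i \<in> Q}"
      show "\<forall>i\<in>K. \<rho> i = \<rho>\<^sub>0 i"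
      proof
        fix i assume "i \<in> K"
        then have "(i, \<rho>\<^sub>0 i) \<in> {(i, \<rho>\<^sub>0 i) |i. i < n \<and> \<rho>\<^sub>0 i \<in> Q}" by (simp add: K_def)
        then have "(i, \<rho>\<^sub>0 i) \<in> {(i, \<rho> i) |i. i < n \<and> \<rho> i \<in> Q}" by (simp only: eq)
        then show "\<rho> i = \<rho>\<^sub>0 i" by simp
      qed
    next
      \<comment> \<open>Every position in \<open>Q\<close> below \<open>n\<close> is already taken
        by a coordinate of \<open>K\<close>, so by injectivity \<rho> sends no other coordinate
        below \<open>n\<close> into \<open>Q\<close>.\<close>
      assume agree: "\<forall>i\<in>K. \<rho> i = \<rho>\<^sub>0 i"
      have "i \<in> K" if i: "i < n" "\<rho> i \<in> Q" for i
      proof -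
        have "\<rho> i \<in> \<rho>\<^sub>0 ` {..<n}"
          using permutes_image[OF \<rho>\<^sub>0] permutes_in_image[OF \<rho>, of i] i by simp
        then obtain j where j: "j < n" "\<rho> i = \<rho>\<^sub>0 j" by auto
        then have "j \<in> K" using i by (simp add: K_def)
        then have "\<rho> j = \<rho> i" using agree j by simp
        then have "j = i" using permutes_inj[OF \<rho>] by (meson injD)
        then show ?thesis using \<open>j \<in> K\<close> by simp
      qed
      moreover have "i < n \<and> \<rho> i \<in> Q" if "i \<in> K" for i
        using that agree by (simp add: K_def)
      ultimately have "{i. i < n \<and> \<rho> i \<in> Q} = K" by blast
      then have "(\<lambda>i. (i, \<rho> i)) ` {i. i < n \<and> \<rho> i \<in> Q} = (\<lambda>i. (i, \<rho>\<^sub>0 i)) ` K"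
        using agree by (intro image_cong) auto
      then show "{(i, \<rho> i) |i. i < n \<and> \<rho> i \<in> Q} = {(i, \<rho>\<^sub>0 i) |i. i < n \<and> \<rho>\<^sub>0 i \<in> Q}"
        unfolding K_def by (simp only: image_Collect)
    qed
    have points: "map (edge_point n J \<rho>) S = map (edge_point n J \<rho>\<^sub>0) S"
      if \<rho>: "\<rho> permutes {..<n}" and eq: "{(i, \<rho> i) |i. i < n \<and> \<rho> i \<in> Q} = {(i, \<rho>\<^sub>0 i) |i. i < n \<and> \<rho>\<^sub>0 i \<in> Q}" for \<rho>
    proof (rule map_cong[OF refl])
      fix s assume "s \<in> set S"
      then have sub: "edge J s \<subseteq> Q" by (auto simp: Q_def)
      have "\<rho> i \<in> edge J s \<longleftrightarrow> \<rho>\<^sub>0 i \<in> edge J s" if i: "i < n" for i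
      proof -
        have "(i, p) \<in> {(i, \<rho> i) |i. i < n \<and> \<rho> i \<in> Q} \<longleftrightarrow> (i, p) \<in> {(i, \<rho>\<^sub>0 i) |i. i < n \<and> \<rho>\<^sub>0 i \<in> Q}" for p
          by (simp only: eq)
        then have graph: "(p = \<rho> i \<and> \<rho> i \<in> Q) \<longleftrightarrow> (p = \<rho>\<^sub>0 i \<and> \<rho>\<^sub>0 i \<in> Q)" for p using i by simp
        show ?thesis using graph[of "\<rho> i"] graph[of "\<rho>\<^sub>0 i"] subsetD[OF sub] by metis
      qed
      then show "edge_point n J \<rho> s = edge_point n J \<rho>\<^sub>0 s" by (simp add: edge_point_def)
    qed
    let ?F = "\<lambda>\<rho>. {(i, \<rho> i) |i. i < n \<and> \<rho> i \<in> Q} = {(i, \<rho>\<^sub>0 i) |i. i < n \<and> \<rho>\<^sub>0 i \<in> Q}"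
    have fibre_eq: "{\<rho> \<in> ?P. ?F \<rho>} = agreeing n \<rho>\<^sub>0 K"
      unfolding agreeing_def mem_Collect_eq by (rule Collect_cong, rule conj_cong[OF refl], rule fibre)
    have "map (edge_point n J \<rho>) S = map (edge_point n J \<rho>\<^sub>0) S" if "\<rho> \<in> agreeing n \<rho>\<^sub>0 K" for \<rho>
      using that points unfolding fibre_eq[symmetric] by blast
    then have "{\<rho> \<in> agreeing n \<rho>\<^sub>0 K. ?bad \<rho>} = {\<rho> \<in> agreeing n \<rho>\<^sub>0 K.
        \<not> all_queries (good_query J Q \<rho>) A (yes_fun J \<rho> t) (map (edge_point n J \<rho>\<^sub>0) S)}"
      by (metis (no_types, lifting))
    moreover have "{\<rho> \<in> ?P. ?F \<rho> \<and> ?bad \<rho>} = {\<rho> \<in> {\<rho> \<in> ?P. ?F \<rho>}. ?bad \<rho>}"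
      by (simp only: mem_Collect_eq conj_assoc)
    ultimately have fibre_bad: "{\<rho> \<in> ?P. ?F \<rho> \<and> ?bad \<rho>} = {\<rho> \<in> agreeing n \<rho>\<^sub>0 K.
        \<not> all_queries (good_query J Q \<rho>) A (yes_fun J \<rho> t) (map (edge_point n J \<rho>\<^sub>0) S)}"
      by (simp only: fibre_eq)
    have "card K \<le> card Q"
      by (rule card_inj_on_le[where f = \<rho>\<^sub>0])
        (use Q inj_on_subset[OF permutes_inj[OF \<rho>\<^sub>0]] in \<open>auto simp: K_def\<close>)
    then have cK: "card K + M * L \<le> \<kappa>" using Q mL by linarith
    show "real (card {\<rho> \<in> ?P. ?F \<rho> \<and> ?bad \<rho>}) \<le> real M * \<delta> * real (card {\<rho> \<in> ?P. ?F \<rho>})"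
      unfolding fibre_eq fibre_bad \<delta>_def
    proof (rule card_bad_queries[OF A])
      show "3 * (real n - real J) \<le> 2 * (real n - real \<kappa> - real L)" using junk n by auto
      show "isolated J Q \<rho>\<^sub>0 K" by (simp add: isolated_def K_def)
    qed (use n \<kappa> \<rho>\<^sub>0 cK S in \<open>auto simp: K_def\<close>)
  qed
  then show ?thesis by simp
qed

text \<open>Toggling the orientation of the blocks in \<open>T\<close> is an injection on the
  instances that leaves the sample points unchanged. Off the bad event it turns a yes-instance into
  a no-instance with the same answers to all queries asked.\<close>

lemma card_yes_le_card_no:
  fixes J n N L \<kappa> :: nat
  defines "\<delta> \<equiv> real L * real \<kappa> * (4 / (real n - real \<kappa>)) + (2 / 3) ^ L"
    and "\<Omega> \<equiv> {\<rho>. \<rho> permutes {..<n}} \<times> Pow {..<N}"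
  assumes A: "bounded_alg n m M A" and n: "J + 4 * N = n"
    and \<kappa>: "\<kappa> < n" and junk: "12 * real N \<le> 2 * (real n - real \<kappa> - real L)"
    and S: "set S \<subseteq> {..<N} \<times> {..<4}" "length S = m" and mL: "2 * m + M * L \<le> \<kappa>"
    and distinct: "distinct (map fst S)"
  shows "real (card {\<omega> \<in> \<Omega>. run A (yes_fun J (fst \<omega>) (snd \<omega>)) (map (edge_point n J (fst \<omega>)) S)})
     \<le> real (card {\<omega> \<in> \<Omega>. run A (no_fun J (fst \<omega>) (snd \<omega>)) (map (edge_point n J (fst \<omega>)) S)})
       + real M * \<delta> * real (card \<Omega>)"
proof -
  define Q where "Q = (\<Union>s\<in>set S. edge J s)"
  define T where "T = {b. (b, 1) \<in> set S \<or> (b, 2) \<in> set S}"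
  let ?bad = "\<lambda>(\<rho>, t). \<not> all_queries (good_query J Q \<rho>) A (yes_fun J \<rho> t) (map (edge_point n J \<rho>) S)"
  let ?yes = "\<lambda>(\<rho>, t). run A (yes_fun J \<rho> t) (map (edge_point n J \<rho>) S)"
  let ?no = "\<lambda>(\<rho>, t). run A (no_fun J \<rho> t) (map (edge_point n J \<rho>) S)"
  have fin: "finite \<Omega>" unfolding \<Omega>_def by (intro finite_cartesian_product finite_permutations) auto
  have bad: "real (card {\<omega> \<in> \<Omega>. ?bad \<omega>}) \<le> real M * \<delta> * real (card \<Omega>)"
  proof (rule card_le_by_fibres[OF fin, where \<phi> = snd])
    fix \<omega> assume "\<omega> \<in> \<Omega>"
    then obtain \<rho>\<^sub>0 t where \<omega>: "\<omega> = (\<rho>\<^sub>0, t)" "t \<in> Pow {..<N}" by (auto simp: \<Omega>_def)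
    have 1: "{y \<in> \<Omega>. snd y = snd \<omega> \<and> ?bad y} = (\<lambda>\<rho>. (\<rho>, t)) ` {\<rho>. \<rho> permutes {..<n} \<and>
        \<not> all_queries (good_query J Q \<rho>) A (yes_fun J \<rho> t) (map (edge_point n J \<rho>) S)}"
      using \<omega> by (auto simp: \<Omega>_def)
    have 2: "{y \<in> \<Omega>. snd y = snd \<omega>} = (\<lambda>\<rho>. (\<rho>, t)) ` {\<rho>. \<rho> permutes {..<n}}"
      using \<omega> by (auto simp: \<Omega>_def)
    have inj: "inj_on (\<lambda>\<rho>. (\<rho>, t)) X" for X :: "(nat \<Rightarrow> nat) set" by (auto intro: inj_onI)
    show "real (card {y \<in> \<Omega>. snd y = snd \<omega> \<and> ?bad y}) \<le> real M * \<delta> * real (card {y \<in> \<Omega>. snd y = snd \<omega>})"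
      unfolding 1 2 card_image[OF inj] unfolding \<delta>_def Q_def
      by (rule card_bad_given_samples[OF A n \<kappa> junk S mL])
  qed
  have "card {\<omega> \<in> \<Omega>. ?yes \<omega> \<and> \<not> ?bad \<omega>} \<le> card {\<omega> \<in> \<Omega>. ?no \<omega>}"
  proof (rule card_inj_on_le[where f = "\<lambda>(\<rho>, t). (\<rho>, sym_diff t T)"])
    have invol: "sym_diff (sym_diff t T) T = t" for t by auto
    show "inj_on (\<lambda>(\<rho>, t). (\<rho>, sym_diff t T)) {\<omega> \<in> \<Omega>. ?yes \<omega> \<and> \<not> ?bad \<omega>}"
    proof (rule inj_onI)
      fix \<omega> \<omega>' :: "(nat \<Rightarrow> nat) \<times> nat set"
      assume eq: "(case \<omega> of (\<rho>, t) \<Rightarrow> (\<rho>, sym_diff t T)) = (case \<omega>' of (\<rho>, t) \<Rightarrow> (\<rho>, sym_diff t T))"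
      then have "sym_diff (sym_diff (snd \<omega>) T) T = sym_diff (sym_diff (snd \<omega>') T) T"
        by (simp add: case_prod_beta)
      then have "snd \<omega> = snd \<omega>'" by (simp only: invol)
      with eq show "\<omega> = \<omega>'" by (simp add: case_prod_beta prod_eq_iff)
    qed
    show "(\<lambda>(\<rho>, t). (\<rho>, sym_diff t T)) ` {\<omega> \<in> \<Omega>. ?yes \<omega> \<and> \<not> ?bad \<omega>} \<subseteq> {\<omega> \<in> \<Omega>. ?no \<omega>}"
    proof (rule image_subsetI)
      fix \<omega> assume "\<omega> \<in> {\<omega> \<in> \<Omega>. ?yes \<omega> \<and> \<not> ?bad \<omega>}"
      then obtain \<rho> t where \<omega>: "\<omega> = (\<rho>, t)" "(\<rho>, t) \<in> \<Omega>"
          "run A (yes_fun J \<rho> t) (map (edge_point n J \<rho>) S)"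
          "all_queries (good_query J Q \<rho>) A (yes_fun J \<rho> t) (map (edge_point n J \<rho>) S)" by auto
      have "yes_fun J \<rho> t x = no_fun J \<rho> (sym_diff t T) x" if x: "good_query J Q \<rho> x" for x
        unfolding yes_fun_def no_fun_def T_def
      proof (rule no_val_eq_yes_val[symmetric])
        show "inj_on fst (set S)" using distinct by (simp add: distinct_map)
        show "(\<exists>p\<in>\<rho> ` supp x. p < J) \<or> (\<forall>p\<in>\<rho> ` supp x. \<forall>q\<in>\<rho> ` supp x. p \<noteq> q \<longrightarrow> same_block J p q \<longrightarrow>
            p \<in> (\<Union>s\<in>set S. edge J s) \<and> q \<in> (\<Union>s\<in>set S. edge J s))"
        proof (cases "\<exists>i\<in>supp x. \<rho> i < J")
          case False
          then have iso: "isolated J Q \<rho> (supp x)" using x by (simp add: good_query_def)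
          show ?thesis
          proof (intro disjI2 ballI impI)
            fix p q assume "p \<in> \<rho> ` supp x" "q \<in> \<rho> ` supp x" and pq: "p \<noteq> q" "same_block J p q"
            then obtain i j where ij: "i \<in> supp x" "p = \<rho> i" "j \<in> supp x" "q = \<rho> j" by auto
            then have "i \<noteq> j" using pq by auto
            then show "p \<in> (\<Union>s\<in>set S. edge J s) \<and> q \<in> (\<Union>s\<in>set S. edge J s)"
              using iso[unfolded isolated_def, rule_format, of i j] ij pq unfolding Q_def by simp
          qed
        qed auto
      qed (use S(1) in auto)
      then have "run A (yes_fun J \<rho> t) (map (edge_point n J \<rho>) S)
          = run A (no_fun J \<rho> (sym_diff t T)) (map (edge_point n J \<rho>) S)"
        by (rule run_eq_if_all_queries[OF \<omega>(4)])
      moreover have "T \<subseteq> {..<N}" using S(1) by (auto simp: T_def)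
      ultimately show "(\<lambda>(\<rho>, t). (\<rho>, sym_diff t T)) \<omega> \<in> {\<omega> \<in> \<Omega>. ?no \<omega>}"
        using \<omega> by (auto simp: \<Omega>_def)
    qed
  qed (use fin in auto)
  moreover have "card {\<omega> \<in> \<Omega>. ?yes \<omega>} \<le> card ({\<omega> \<in> \<Omega>. ?yes \<omega> \<and> \<not> ?bad \<omega>} \<union> {\<omega> \<in> \<Omega>. ?bad \<omega>})"
    by (rule card_mono) (use fin in auto)
  moreover have "\<dots> \<le> card {\<omega> \<in> \<Omega>. ?yes \<omega> \<and> \<not> ?bad \<omega>} + card {\<omega> \<in> \<Omega>. ?bad \<omega>}"
    by (rule card_Un_le)
  ultimately have "real (card {\<omega> \<in> \<Omega>. ?yes \<omega>}) \<le> real (card {\<omega> \<in> \<Omega>. ?no \<omega>}) + real M * \<delta> * real (card \<Omega>)"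
    using bad by linarith
  then show ?thesis by (simp add: case_prod_beta)
qed

section \<open>Averaging over the random instance\<close>

lemma replicate_pmf_map: "replicate_pmf m (map_pmf h p) = map_pmf (map h) (replicate_pmf m p)"
  by (induction m) (simp_all add: map_pmf_def bind_assoc_pmf bind_return_pmf)

lemma pmf_bind_ge:
  assumes "\<And>x. x \<in> set_pmf p \<Longrightarrow> c \<le> pmf (k x) b"
  shows "c \<le> pmf (bind_pmf p k) b"
  unfolding pmf_bind
  by (rule measure_pmf.integral_ge_const)
    (auto intro!: measure_pmf.integrable_const_bound[where B = 1] simp: pmf_le_1 AE_measure_pmf_iff assms)

text \<open>\<open>B\<close> collects the exceptional outcomes on which only the trivial bound 1 is
  available; they cost their probability.\<close>

lemma pmf_bind_le_add:
  fixes p :: "'a pmf"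
  assumes "\<And>x. x \<in> set_pmf p \<Longrightarrow> pmf (k x) b \<le> pmf (k' x) b + c + indicator B x"
  shows "pmf (bind_pmf p k) b \<le> pmf (bind_pmf p k') b + c + measure_pmf.prob p B"
proof -
  have int: "integrable (measure_pmf p) (\<lambda>x. pmf (k x) b)" for k
    by (rule measure_pmf.integrable_const_bound[where B = 1]) (auto simp: pmf_le_1)
  have ind: "integrable (measure_pmf p) (indicator B :: 'a \<Rightarrow> real)"
    by (rule measure_pmf.integrable_const_bound[where B = 1]) (auto simp: indicator_def)
  have "pmf (bind_pmf p k) b \<le> (\<integral>x. pmf (k' x) b + c + indicator B x \<partial>measure_pmf p)"
    unfolding pmf_bind
    by (rule integral_mono_AE) (auto intro!: Bochner_Integration.integrable_add int ind simp: AE_measure_pmf_iff assms)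
  also have "\<dots> = pmf (bind_pmf p k') b + c + measure_pmf.prob p B"
    unfolding pmf_bind by (simp add: int ind)
  finally show ?thesis .
qed

text \<open>Samples are drawn abstractly from \<open>E\<close> and turned into points by
  \<open>h\<close> afterwards, which separates them from the hidden permutation.\<close>

lemma prob_output_map_pmf:
  "prob_output ALG m f (map_pmf h E) b
     = pmf (do {A \<leftarrow> ALG; S \<leftarrow> replicate_pmf m E; return_pmf (run A f (map h S))}) b"
proof -
  have "prob_output ALG m f (map_pmf h E) b
      = pmf (map_pmf (\<lambda>(A, S). run A f S) (pair_pmf ALG (replicate_pmf m (map_pmf h E)))) b"
    unfolding prob_output_def pmf_map by (rule arg_cong[where f = "measure_pmf.prob _"]) auto
  then show ?thesis
    unfolding replicate_pmf_map by (simp add: pair_pmf_def map_pmf_def bind_assoc_pmf bind_return_pmf)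
qed

text \<open>Birthday bound: at most \<open>m\<close> blocks are already used, each with 4 of the
  \<open>4 * N\<close> edges, so a new sample collides with probability at most
  \<open>m / N\<close>; and \<open>m^2 + m \<le> (m + 1)^2\<close>.\<close>

lemma prob_collision:
  assumes N: "0 < N"
  shows "measure_pmf.prob (replicate_pmf m (pmf_of_set ({..<N} \<times> {..<4::nat}))) {S. \<not> distinct (map fst S)}
     \<le> real m ^ 2 / real N"
proof (induction m)
  case 0
  then show ?case by simp
next
  case (Suc m)
  let ?E = "pmf_of_set ({..<N} \<times> {..<4::nat})"
  let ?R = "replicate_pmf m ?E"
  let ?coll = "\<lambda>S :: (nat \<times> nat) list. \<not> distinct (map fst S)"
  have prob: "measure_pmf.prob p {S. ?coll S} = pmf (map_pmf ?coll p) True" for p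
    unfolding pmf_map by (rule arg_cong[where f = "measure_pmf.prob p"]) auto
  have E: "finite ({..<N} \<times> {..<4::nat})" "{..<N} \<times> {..<4::nat} \<noteq> {}"
    using N by (auto simp: lessThan_empty_iff)
  \<comment> \<open>The recursion draws the head first; commuting the draws makes the head the new
    sample.\<close>
  have "replicate_pmf (Suc m) ?E = do {xs \<leftarrow> ?R; x \<leftarrow> ?E; return_pmf (x # xs)}"
    unfolding replicate_pmf.simps by (rule bind_commute_pmf)
  then have "map_pmf ?coll (replicate_pmf (Suc m) ?E)
      = bind_pmf ?R (\<lambda>xs. map_pmf (\<lambda>x. ?coll (x # xs)) ?E)"
    by (simp only: map_pmf_def bind_assoc_pmf bind_return_pmf)
  then have "measure_pmf.prob (replicate_pmf (Suc m) ?E) {S. ?coll S}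
      = pmf (bind_pmf ?R (\<lambda>xs. map_pmf (\<lambda>x. ?coll (x # xs)) ?E)) True"
    by (simp only: prob)
  also have "\<dots> \<le> pmf (bind_pmf ?R (\<lambda>xs. return_pmf (?coll xs))) True + real m / real N
      + measure_pmf.prob ?R {}"
  proof (rule pmf_bind_le_add)
    fix xs assume "xs \<in> set_pmf ?R"
    then have len: "length xs = m" by (simp add: set_replicate_pmf)
    show "pmf (map_pmf (\<lambda>x. ?coll (x # xs)) ?E) True
        \<le> pmf (return_pmf (?coll xs)) True + real m / real N + indicator {} xs"
    proof (cases "?coll xs")
      case True
      then show ?thesis by (simp add: pmf_le_1 add_increasing2)
    next
      case False
      let ?F = "set (map fst xs)"
      have "card (({..<N} \<times> {..<4}) \<inter> (\<lambda>x. ?coll (x # xs)) -` {True}) \<le> card (?F \<times> {..<4::nat})"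
        by (rule card_mono) (use False in force)+
      also have "\<dots> \<le> 4 * m" using card_length[of "map fst xs"] len by (simp add: card_cartesian_product)
      finally have "real (card (({..<N} \<times> {..<4}) \<inter> (\<lambda>x. ?coll (x # xs)) -` {True})) \<le> 4 * real m"
        by linarith
      then have "real (card (({..<N} \<times> {..<4}) \<inter> (\<lambda>x. ?coll (x # xs)) -` {True})) / (4 * real N)
          \<le> 4 * real m / (4 * real N)"
        by (rule divide_right_mono) simp
      then show ?thesis
        using False by (simp add: pmf_map measure_pmf_of_set[OF E(2,1)] card_cartesian_product mult.commute)
    qed
  qed
  also have "\<dots> = measure_pmf.prob ?R {S. ?coll S} + real m / real N"
    unfolding prob by (simp add: map_pmf_def)
  also have "\<dots> \<le> real m ^ 2 / real N + real m / real N" using Suc.IH by simp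
  also have "\<dots> \<le> real (Suc m) ^ 2 / real N"
    by (simp add: add_divide_distrib[symmetric] power2_eq_square algebra_simps divide_right_mono)
  finally show ?case .
qed

text \<open>Averaged over the random instance, the algorithm outputs 1 with probability at least 5/6
  on yes-instances and at most 1/6 on no-instances. The gap of 2/3 must be paid by bad queries and
  colliding samples.\<close>

lemma tester_lower_bound:
  fixes J n N L \<kappa> m M :: nat and ALG :: "det_alg pmf"
  assumes ALG: "randomized_alg n m M ALG" and n: "J + 4 * N = n" and N: "0 < N"
    and \<kappa>: "\<kappa> < n" and junk: "12 * real N \<le> 2 * (real n - real \<kappa> - real L)"
    and mL: "2 * m + M * L \<le> \<kappa>" and \<epsilon>: "\<epsilon> \<le> 1 / 4"
    and yes: "\<And>f D. set_pmf D \<subseteq> cube n \<Longrightarrow> monotone_decision_list n f \<Longrightarrow> prob_output ALG m f D True \<ge> 5 / 6"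
    and no: "\<And>f D. set_pmf D \<subseteq> cube n \<Longrightarrow> far_from_linear_threshold \<epsilon> n D f \<Longrightarrow> prob_output ALG m f D False \<ge> 5 / 6"
  shows "2 / 3 \<le> real M * (real L * real \<kappa> * (4 / (real n - real \<kappa>)) + (2 / 3) ^ L) + real m ^ 2 / real N"
proof -
  define \<beta> where "\<beta> = real M * (real L * real \<kappa> * (4 / (real n - real \<kappa>)) + (2 / 3) ^ L)"
  define \<Omega> where "\<Omega> = {\<rho>. \<rho> permutes {..<n}} \<times> Pow {..<N}"
  define E where "E = pmf_of_set ({..<N} \<times> {..<4::nat})"
  let ?R = "replicate_pmf m E"
  let ?D = "\<lambda>\<omega> :: (nat \<Rightarrow> nat) \<times> nat set. map_pmf (edge_point n J (fst \<omega>)) E"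
  define V where "V F = do {\<omega> \<leftarrow> pmf_of_set \<Omega>; A \<leftarrow> ALG; S \<leftarrow> ?R;
      return_pmf (run A (F \<omega>) (map (edge_point n J (fst \<omega>)) S))}" for F :: "(nat \<Rightarrow> nat) \<times> nat set \<Rightarrow> point \<Rightarrow> bool"
  let ?yes = "\<lambda>\<omega>. yes_fun J (fst \<omega>) (snd \<omega>)"
  let ?no = "\<lambda>\<omega>. no_fun J (fst \<omega>) (snd \<omega>)"
  have \<Omega>: "finite \<Omega>" "\<Omega> \<noteq> {}"
    unfolding \<Omega>_def using permutes_id[of "{..<n}"]
    by (blast intro!: finite_cartesian_product finite_permutations)+
  have \<omega>: "fst \<omega> permutes {..<n}" if "\<omega> \<in> set_pmf (pmf_of_set \<Omega>)" for \<omega>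
    using that \<Omega> by (auto simp: \<Omega>_def)
  have cube: "set_pmf (?D \<omega>) \<subseteq> cube n" for \<omega> by auto
  have "5 / 6 \<le> pmf (V ?yes) True"
    unfolding V_def
  proof (rule pmf_bind_ge)
    fix \<omega> assume "\<omega> \<in> set_pmf (pmf_of_set \<Omega>)"
    then show "5 / 6 \<le> pmf (do {A \<leftarrow> ALG; S \<leftarrow> ?R;
        return_pmf (run A (?yes \<omega>) (map (edge_point n J (fst \<omega>)) S))}) True"
      using yes[OF cube monotone_decision_list_yes_fun[OF \<omega> n]] by (simp only: prob_output_map_pmf)
  qed
  moreover have "5 / 6 \<le> pmf (V ?no) False"
    unfolding V_def
  proof (rule pmf_bind_ge)
    fix \<omega> assume "\<omega> \<in> set_pmf (pmf_of_set \<Omega>)"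
    then show "5 / 6 \<le> pmf (do {A \<leftarrow> ALG; S \<leftarrow> ?R;
        return_pmf (run A (?no \<omega>) (map (edge_point n J (fst \<omega>)) S))}) False"
      using no[OF cube far_no_fun[OF \<omega> n N \<epsilon>, folded E_def]] by (simp only: prob_output_map_pmf)
  qed
  moreover have "pmf (V ?no) True + pmf (V ?no) False = 1"
    by (simp add: pmf_False_conv_True)
  moreover have "pmf (V ?yes) True \<le> pmf (V ?no) True + (\<beta> + real m ^ 2 / real N)"
  proof -
    let ?G = "\<lambda>F A S. map_pmf (\<lambda>\<omega>. run A (F \<omega>) (map (edge_point n J (fst \<omega>)) S)) (pmf_of_set \<Omega>)"
    \<comment> \<open>The strategy and the abstract samples are independent of the instance, so the
      instance can be drawn last and counted for fixed \<open>A\<close> and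
      \<open>S\<close>.\<close>
    have V: "V F = do {A \<leftarrow> ALG; S \<leftarrow> ?R; ?G F A S}" for F
      unfolding V_def map_pmf_def
      by (subst bind_commute_pmf, rule bind_pmf_cong[OF refl], rule bind_commute_pmf)
    have G: "pmf (?G F A S) True
        = real (card {\<omega> \<in> \<Omega>. run A (F \<omega>) (map (edge_point n J (fst \<omega>)) S)}) / real (card \<Omega>)" for F A S
      unfolding pmf_map measure_pmf_of_set[OF \<Omega>(2,1)]
      by (rule arg_cong[where f = "\<lambda>X. real (card X) / real (card \<Omega>)"]) auto
    have \<beta>: "0 \<le> \<beta>" using \<kappa> by (simp add: \<beta>_def)
    have inner: "pmf (?G ?yes A S) True \<le> pmf (?G ?no A S) True + \<beta> + indicator {S. \<not> distinct (map fst S)} S"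
      if A: "A \<in> set_pmf ALG" and S: "S \<in> set_pmf ?R" for A S
    proof (cases "distinct (map fst S)")
      case True
      have A': "bounded_alg n m M A" using A ALG by (simp add: randomized_alg_def)
      have "set_pmf E = {..<N} \<times> {..<4}"
        unfolding E_def by (rule set_pmf_of_set) (use N in \<open>auto simp: lessThan_empty_iff\<close>)
      then have S': "set S \<subseteq> {..<N} \<times> {..<4}" "length S = m" using S by (auto simp: set_replicate_pmf)
      have "real (card {\<omega> \<in> \<Omega>. run A (?yes \<omega>) (map (edge_point n J (fst \<omega>)) S)})
          \<le> real (card {\<omega> \<in> \<Omega>. run A (?no \<omega>) (map (edge_point n J (fst \<omega>)) S)}) + \<beta> * real (card \<Omega>)"
        unfolding \<beta>_def \<Omega>_def by (rule card_yes_le_card_no[OF A' n \<kappa> junk S' mL True])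
      then have "pmf (?G ?yes A S) True \<le> pmf (?G ?no A S) True + \<beta>"
        unfolding G using \<Omega> by (simp add: field_simps card_gt_0_iff)
      then show ?thesis using True by simp
    next
      case False
      have "pmf (?G ?yes A S) True \<le> 1" by (rule pmf_le_1)
      also have "1 \<le> pmf (?G ?no A S) True + \<beta> + 1" using \<beta> by simp
      finally show ?thesis using False by simp
    qed
    have "pmf (bind_pmf ?R (?G ?yes A)) True \<le> pmf (bind_pmf ?R (?G ?no A)) True
        + (\<beta> + real m ^ 2 / real N) + indicator {} A" if "A \<in> set_pmf ALG" for A
    proof -
      have "pmf (bind_pmf ?R (?G ?yes A)) True \<le> pmf (bind_pmf ?R (?G ?no A)) True + \<beta>
          + measure_pmf.prob ?R {S. \<not> distinct (map fst S)}"
        by (rule pmf_bind_le_add) (rule inner[OF that])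
      then show ?thesis using prob_collision[OF N, of m, folded E_def] by simp
    qed
    then have "pmf (bind_pmf ALG (\<lambda>A. bind_pmf ?R (?G ?yes A))) True
        \<le> pmf (bind_pmf ALG (\<lambda>A. bind_pmf ?R (?G ?no A))) True + (\<beta> + real m ^ 2 / real N)
          + measure_pmf.prob ALG {}"
      by (rule pmf_bind_le_add)
    then show ?thesis unfolding V by simp
  qed
  ultimately show ?thesis unfolding \<beta>_def by linarith
qed

section \<open>Choice of parameters and asymptotics\<close>

theorem theorem7p7:
  fixes \<epsilon> :: real
  assumes "0 < \<epsilon>" and "\<epsilon> \<le> 1 / 4"
  shows "\<exists>c>0. \<forall>\<^sub>F n in at_top. \<forall>(m::nat) (M::nat) (ALG :: det_alg pmf).
           randomized_alg n m M ALG \<longrightarrow>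
           (\<forall>(f :: point \<Rightarrow> bool) (D :: point pmf). set_pmf D \<subseteq> cube n \<longrightarrow>
              (monotone_decision_list n f \<longrightarrow> prob_output ALG m f D True \<ge> 5 / 6) \<and>
              (far_from_linear_threshold \<epsilon> n D f \<longrightarrow> prob_output ALG m f D False \<ge> 5 / 6)) \<longrightarrow>
           real (m + M) \<ge> c * (sqrt (real n) / ln (real n))"
proof (intro exI conjI)
  \<comment> \<open>The constant is chosen generously: if the bound fails, each of the three error
    terms below is at most 1/100, far from their required sum of 2/3.\<close>
  show "(0::real) < 1 / 200" by simp
  have "\<forall>\<^sub>F n :: nat in at_top. ln (real n) \<ge> 1" "\<forall>\<^sub>F n :: nat in at_top. 4 * ln (real n) \<le> real n / 8"
    by real_asymp+
  with eventually_ge_at_top[of "16::nat"]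
  show "\<forall>\<^sub>F n in at_top. \<forall>(m::nat) (M::nat) (ALG :: det_alg pmf).
           randomized_alg n m M ALG \<longrightarrow>
           (\<forall>(f :: point \<Rightarrow> bool) (D :: point pmf). set_pmf D \<subseteq> cube n \<longrightarrow>
              (monotone_decision_list n f \<longrightarrow> prob_output ALG m f D True \<ge> 5 / 6) \<and>
              (far_from_linear_threshold \<epsilon> n D f \<longrightarrow> prob_output ALG m f D False \<ge> 5 / 6)) \<longrightarrow>
           real (m + M) \<ge> 1 / 200 * (sqrt (real n) / ln (real n))"
  proof eventually_elim
    case (elim n)
    show ?case
    proof (intro allI impI, rule ccontr)
      fix m M :: nat and ALG :: "det_alg pmf"
      assume ALG: "randomized_alg n m M ALG"
        and correct: "\<forall>(f :: point \<Rightarrow> bool) (D :: point pmf). set_pmf D \<subseteq> cube n \<longrightarrow>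
              (monotone_decision_list n f \<longrightarrow> prob_output ALG m f D True \<ge> 5 / 6) \<and>
              (far_from_linear_threshold \<epsilon> n D f \<longrightarrow> prob_output ALG m f D False \<ge> 5 / 6)"
        and "\<not> real (m + M) \<ge> 1 / 200 * (sqrt (real n) / ln (real n))"
      define s where "s = sqrt (real n)"
      define l where "l = ln (real n)"
      have l: "1 \<le> l" "4 * l \<le> real n / 8" using elim by (auto simp: l_def)
      have ss: "s * s = real n" and s4: "4 \<le> s"
        using elim by (auto simp: s_def intro!: real_le_rsqrt)
      have "real (m + M) < 1 / 200 * (s / l)"
        using \<open>\<not> _\<close> by (simp add: s_def l_def)
      then have q: "(real m + real M) * l < s / 200" using l by (simp add: field_simps)
      have mM: "real m + real M \<le> (real m + real M) * l"
        using l by (simp add: mult_le_cancel_left1)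
      \<comment> \<open>Since \<open>27 / 8\<close> exceeds \<open>exp 1\<close>,
        \<open>3 * ln (2 / 3) \<le> - 1\<close>; so this length makes \<open>(2 / 3) ^ L\<close> at
        most \<open>1 / n\<close>.\<close>
      define L where "L = nat \<lceil>3 * l\<rceil>"
      \<comment> \<open>The budget of exposed coordinates: two per sample and \<open>L\<close> per
        query.\<close>
      define \<kappa> where "\<kappa> = 2 * m + M * L"
      have L: "3 * l \<le> real L" "real L \<le> 4 * l"
      proof -
        have "0 \<le> 3 * l" using l by simp
        then show "3 * l \<le> real L" unfolding L_def by linarith
        have "real L \<le> 3 * l + 1" unfolding L_def using \<open>0 \<le> 3 * l\<close> by linarith
        then show "real L \<le> 4 * l" using l by simp
      qed
      have "real \<kappa> = 2 * real m + real M * real L" by (simp add: \<kappa>_def)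
      also have "\<dots> \<le> 4 * (real m * l) + real M * (4 * l)"
      proof (rule add_mono)
        have "real m * 1 \<le> real m * l" by (rule mult_left_mono[OF l(1)]) simp
        then show "2 * real m \<le> 4 * (real m * l)" using of_nat_0_le_iff[of m] by linarith
        show "real M * real L \<le> real M * (4 * l)" using L(2) by (rule mult_left_mono) simp
      qed
      also have "\<dots> < s / 50" using q by (simp add: algebra_simps)
      finally have \<kappa>s: "real \<kappa> < s / 50" .
      have sn: "4 * s \<le> real n" using s4 ss by (metis mult_right_mono order.trans zero_le_numeral)
      \<comment> \<open>Blocks fill at most half of the positions. Then
        \<open>12 * N \<le> 3 * n / 2\<close>, which leaves room for \<open>\<kappa> + L\<close> up
        to \<open>n / 4\<close> in \<open>junk\<close>.\<close>
      define N where "N = n div 8"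
      define J where "J = n - 4 * N"
      have N: "0 < N" "real n / 16 \<le> real N" "real N \<le> real n / 8" and n: "J + 4 * N = n"
        using elim(1) by (auto simp: N_def J_def)
      have \<kappa>n: "\<kappa> < n" using \<kappa>s sn s4 by linarith
      have junk: "12 * real N \<le> 2 * (real n - real \<kappa> - real L)"
      proof -
        have "200 * real \<kappa> \<le> real n" using \<kappa>s sn s4 by simp
        moreover have "8 * real L \<le> real n" using L(2) l(2) by simp
        moreover have "8 * real N \<le> real n" using N(3) by simp
        ultimately show ?thesis unfolding right_diff_distrib by linarith
      qed
      have "2 / 3 \<le> real M * (real L * real \<kappa> * (4 / (real n - real \<kappa>)) + (2 / 3) ^ L) + real m ^ 2 / real N"
        by (rule tester_lower_bound[OF ALG n N(1) \<kappa>n junk _ assms(2)]) (use correct in \<open>auto simp: \<kappa>_def\<close>)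
      \<comment> \<open>The product \<open>M * L * \<kappa>\<close> is at most the square of
        \<kappa>, hence a small multiple of \<open>n\<close>; this is where the square root in the
        bound arises.\<close>
      moreover have "real M * real L * real \<kappa> * (4 / (real n - real \<kappa>)) \<le> 1 / 100"
      proof -
        have "real M * real L \<le> real \<kappa>" by (simp add: \<kappa>_def)
        then have "real M * real L * real \<kappa> \<le> real \<kappa> * real \<kappa>" by (rule mult_right_mono) simp
        also have "\<dots> \<le> (s / 50) * (s / 50)" using \<kappa>s by (intro mult_mono) auto
        also have "\<dots> = real n / 2500" using ss by simp
        finally have "real M * real L * real \<kappa> \<le> real n / 2500" .
        moreover have "4 / (real n - real \<kappa>) \<le> 8 / real n"
          using \<kappa>s sn s4 elim(1) by (simp add: field_simps)
        ultimately have "real M * real L * real \<kappa> * (4 / (real n - real \<kappa>)) \<le> real n / 2500 * (8 / real n)"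
          using \<kappa>n by (intro mult_mono) auto
        also have "\<dots> \<le> 1 / 100" using elim(1) by simp
        finally show ?thesis .
      qed
      moreover have "real M * (2 / 3) ^ L \<le> 1 / 100"
      proof -
        have "ln (8 / 27 :: real) \<le> - 1"
        proof -
          have "exp 1 \<le> (27 / 8 :: real)" using exp_le by linarith
          then have "1 \<le> ln (27 / 8 :: real)" by (subst ln_ge_iff) auto
          moreover have "ln (8 / 27 :: real) = - ln (27 / 8)" using ln_inverse[of "27 / 8 :: real"] by simp
          ultimately show ?thesis by linarith
        qed
        moreover have "ln (8 / 27 :: real) = 3 * ln (2 / 3)"
          using ln_realpow[of "2 / 3 :: real" 3] by (simp add: power_divide)
        ultimately have l3: "3 * ln (2 / 3 :: real) \<le> - 1" by simp
        have "(2 / 3 :: real) ^ L = exp (real L * ln (2 / 3))"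
          by (simp add: exp_of_nat_mult)
        also have "real L * ln (2 / 3 :: real) \<le> (3 * l) * ln (2 / 3)"
          using L(1) by (intro mult_right_mono_neg) auto
        also have "\<dots> \<le> - l" using mult_left_mono[OF l3, of l] l by (simp add: mult_ac)
        finally have "(2 / 3 :: real) ^ L \<le> exp (- l)" by simp
        also have "\<dots> = 1 / real n" using elim(1) by (simp add: l_def exp_minus inverse_eq_divide)
        finally have "real M * (2 / 3) ^ L \<le> real M * (1 / real n)" by (rule mult_left_mono) simp
        also have "\<dots> \<le> 1 / 100" using q mM sn s4 elim(1) by (simp add: field_simps)
        finally show ?thesis .
      qed
      moreover have "real m ^ 2 / real N \<le> 1 / 100"
      proof -
        have "real m ^ 2 \<le> (s / 200) ^ 2" using q mM by (intro power_mono) auto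
        also have "\<dots> = real n / 40000" using ss by (simp add: power2_eq_square)
        also have "\<dots> \<le> real N / 100" using N(2) by simp
        finally show ?thesis using N(1) by (simp add: field_simps)
      qed
      ultimately show False by (simp add: distrib_left mult.assoc)
    qed
  qed
qed

end
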